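(* Let $\mathbb{K}$ be a field of characteristic $0$ and let $I\subset\mathbb{K}[X_1,\dots,X_n]$ be a symmetric ideal. Assume that there exists $P\in I$ of degree $d$ such that $d+\mathrm{wt}(P_d)\le n$. Then for every $m\in\mathrm{Mon}(P_d)$ and every partition $\lambda$ of $n$ with $\lambda\trianglelefteq\mu(m)^\perp$, the ideal $I$ contains the isotypic component $\mathbb{K}[X_1,\dots,X_n]_\lambda$. In other words, $$I_\lambda=\mathbb{K}[X_1,\dots,X_n]_\lambda,$$ or equivalently $$\left(\mathbb{K}[X_1,\dots,X_n]/I\right)_\lambda=\{0\}.$$
   Context: The symmetric group $S_n$ acts on $\mathbb{K}[X_1,\dots,X_n]$ by permuting the variables; an ideal $I$ is symmetric if $\sigma P\in I$ for all $P\in I$, $\sigma\in S_n$. Then $I$ and $\mathbb{K}[X_1,\dots,X_n]/I$ are $\mathbb{K}[S_n]$-modules. In characteristic $0$ the irreducible $\mathbb{K}[S_n]$-modules are, up to isomorphism, the Specht modules $S^\lambda$ indexed by partitions $\lambda$ of $n$ (with the usual convention, in which the span of all Specht polynomials of shape $\lambda$ is isomorphic to $S^\lambda$; a Specht polynomial of shape $\lambda$ is the product, over the columns of a filling of the Young diagram with row lengths $\lambda_i$ by $1,\dots,n$, of the Vandermonde products of the variables indexed by that column). For a $\mathbb{K}[S_n]$-module $U$, $U_\lambda$ denotes its $\lambda$-isotypic component, i.e. the sum of all submodules of $U$ isomorphic to $S^\lambda$. For a polynomial $P$, $P_h$ is its homogeneous component of degree $h$ and $\mathrm{Mon}(P)$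 is the set of monomials appearing in $P$ (with nonzero coefficient). The support of a monomial $\prod_j X_j^{k_j}$ is $\{j:k_j\neq0\}$, its weight is the cardinality of its support, and $\mathrm{wt}(P)$ is the cardinality of the union of the supports of the monomials in $\mathrm{Mon}(P)$. A partition of $n$ is a weakly decreasing sequence of positive integers with sum $n$; $\mathrm{len}$ denotes the number of parts. The dual partition is $(\lambda^\perp)_i=|\{j:\lambda_j\ge i\}|$. For partitions $\lambda,\mu$ of $n$, $\mu$ dominates $\lambda$ (written $\lambda\trianglelefteq\mu$) if $\sum_{j=1}^i\mu_j\ge\sum_{j=1}^i\lambda_j$ for all $1\le i\le\min\{\mathrm{len}(\lambda),\mathrm{len}(\mu)\}$. For a monomial $m$ of degree $d$ and weight $l$ with $d+l\le n$, let $(\lambda_1,\dots,\lambda_l)$ be the partition of $d$ formed by the nonzero exponents of $m$ in decreasing order; then $\mu(m)=(\lambda_1+1,\dots,\lambda_l+1,1,\dots,1)$ with $n-d-l$ trailing ones, a partition of $n$. *)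

theory Defs
  imports "HOL-Algebra.Algebra" "HOL-Algebra.Algebraic_Closure_Type" "HOL-Library.Poly_Mapping"
begin

section \<open>Polynomials and the action of the symmetric group\<close>

text \<open>
  A monomial is its finitely supported exponent function, and a polynomial is the finitely
  supported function that maps monomials to coefficients, with the convolution product.
  So \<open>keys m\<close> is the support of a monomial \<open>m\<close>, \<open>keys p\<close> is the set of monomials appearing
  in a polynomial \<open>p\<close>, and \<open>lookup p m\<close> is the coefficient of \<open>m\<close> in \<open>p\<close>.
  The variables of \<open>\<K>[X\<^sub>1, \<dots>, X\<^sub>n]\<close> are those with index in \<open>{1..n}\<close>.
\<close>

type_synonym mon = "nat \<Rightarrow>\<^sub>0 nat"
type_synonym 'k mpoly = "mon \<Rightarrow>\<^sub>0 'k"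

definition Const :: "'k \<Rightarrow> 'k::comm_ring_1 mpoly" where
  "Const c = Poly_Mapping.single 0 c"

definition Var :: "nat \<Rightarrow> 'k::comm_ring_1 mpoly" where
  "Var i = Poly_Mapping.single (Poly_Mapping.single i 1) 1"

definition polys :: "nat \<Rightarrow> 'k::comm_ring_1 mpoly set" where
  "polys n = {p. \<forall>m\<in>Poly_Mapping.keys p. Poly_Mapping.keys m \<subseteq> {1..n}}"

definition mpoly_ring :: "nat \<Rightarrow> 'k::comm_ring_1 mpoly ring" where
  "mpoly_ring n = \<lparr>carrier = polys n, monoid.mult = (*), monoid.one = 1, ring.zero = 0, ring.add = (+)\<rparr>"

lemma cring_mpoly_ring: "cring (mpoly_ring n)"
proof -
  have keys_add: "Poly_Mapping.keys (a + b) = Poly_Mapping.keys a \<union> Poly_Mapping.keys b" for a b :: mon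
    by (auto simp: in_keys_iff lookup_add)
  have mult: "p * q \<in> polys n" if "p \<in> polys n" "q \<in> polys n" for p q :: "'a mpoly"
  proof -
    have "Poly_Mapping.keys m \<subseteq> {1..n}" if m: "m \<in> Poly_Mapping.keys (p * q)" for m
    proof -
      obtain a b where "a \<in> Poly_Mapping.keys p" "b \<in> Poly_Mapping.keys q" "m = a + b"
        using keys_mult[of p q] m by blast
      then show ?thesis
        using \<open>p \<in> polys n\<close> \<open>q \<in> polys n\<close> by (simp add: polys_def keys_add)
    qed
    then show ?thesis by (simp add: polys_def)
  qed
  have add: "p + q \<in> polys n" if "p \<in> polys n" "q \<in> polys n" for p q :: "'a mpoly"
  proof -
    have "Poly_Mapping.keys m \<subseteq> {1..n}" if m: "m \<in> Poly_Mapping.keys (p + q)" for m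
    proof -
      have "m \<in> Poly_Mapping.keys p \<or> m \<in> Poly_Mapping.keys q"
        using subsetD[OF Poly_Mapping.keys_add m] by (rule UnE) simp_all
      then show ?thesis
        using \<open>p \<in> polys n\<close> \<open>q \<in> polys n\<close> by (elim disjE) (simp_all add: polys_def)
    qed
    then show ?thesis by (simp add: polys_def)
  qed
  have neg: "- p \<in> polys n" if "p \<in> polys n" for p :: "'a mpoly"
    using that by (simp add: polys_def)
  have zero: "(0 :: 'a mpoly) \<in> polys n" and one: "(1 :: 'a mpoly) \<in> polys n"
    by (simp_all add: polys_def)
  have "abelian_group (mpoly_ring n :: 'a mpoly ring)"
  proof (rule abelian_groupI)
    fix p :: "'a mpoly" assume "p \<in> carrier (mpoly_ring n)"
    then show "\<exists>q\<in>carrier (mpoly_ring n). q \<oplus>\<^bsub>mpoly_ring n\<^esub> p = \<zero>\<^bsub>mpoly_ring n\<^esub>"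
      using neg by (intro bexI[of _ "- p"]) (simp_all add: mpoly_ring_def)
  qed (simp_all add: mpoly_ring_def add zero add.assoc)
  moreover have "Group.comm_monoid (mpoly_ring n :: 'a mpoly ring)"
    by (rule comm_monoidI) (simp_all add: mpoly_ring_def mult one mult.assoc)
  ultimately show ?thesis
    by (rule cringI) (simp add: mpoly_ring_def distrib_right)
qed

definition scale :: "'k::comm_ring_1 \<Rightarrow> 'k mpoly \<Rightarrow> 'k mpoly" where
  "scale c p = Const c * p"

definition perm_poly :: "(nat \<Rightarrow> nat) \<Rightarrow> 'k::comm_ring_1 mpoly \<Rightarrow> 'k mpoly" where
  "perm_poly \<sigma> p =
     (\<Sum>m\<in>Poly_Mapping.keys p. Const (Poly_Mapping.lookup p m) *
        (\<Prod>j\<in>Poly_Mapping.keys m. Var (\<sigma> j) ^ Poly_Mapping.lookup m j))"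

definition symmetric :: "nat \<Rightarrow> 'k::comm_ring_1 mpoly set \<Rightarrow> bool" where
  "symmetric n I \<longleftrightarrow> (\<forall>\<sigma>\<in>carrier (sym_group n). \<forall>p\<in>I. perm_poly \<sigma> p \<in> I)"

definition mon_degree :: "mon \<Rightarrow> nat" where
  "mon_degree m = (\<Sum>j\<in>Poly_Mapping.keys m. Poly_Mapping.lookup m j)"

definition mon_weight :: "mon \<Rightarrow> nat" where
  "mon_weight m = card (Poly_Mapping.keys m)"

text \<open>The zero polynomial gets degree 0.\<close>

definition poly_degree :: "'k::comm_ring_1 mpoly \<Rightarrow> nat" where
  "poly_degree p = Max (insert 0 (mon_degree ` Poly_Mapping.keys p))"

definition hom_component :: "nat \<Rightarrow> 'k::comm_ring_1 mpoly \<Rightarrow> 'k mpoly" where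
  "hom_component h p =
     (\<Sum>m\<in>{m\<in>Poly_Mapping.keys p. mon_degree m = h}. Poly_Mapping.single m (Poly_Mapping.lookup p m))"

definition wt :: "'k::comm_ring_1 mpoly \<Rightarrow> nat" where
  "wt p = card (\<Union>m\<in>Poly_Mapping.keys p. Poly_Mapping.keys m)"


section \<open>Partitions\<close>

definition is_partition :: "nat \<Rightarrow> nat list \<Rightarrow> bool" where
  "is_partition n lam \<longleftrightarrow> sorted_wrt (\<ge>) lam \<and> (\<forall>x\<in>set lam. 0 < x) \<and> sum_list lam = n"

definition dual_partition :: "nat list \<Rightarrow> nat list" where
  "dual_partition lam =
     map (\<lambda>i. card {j. j < length lam \<and> i \<le> lam ! j})
       [1..<Suc (Max (insert 0 (set lam)))]"

definition dominated_by :: "nat list \<Rightarrow> nat list \<Rightarrow> bool" (infix \<open>\<unlhd>\<^sub>d\<close> 50) where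
  "lam \<unlhd>\<^sub>d \<mu> \<longleftrightarrow>
     (\<forall>i\<in>{1..min (length lam) (length \<mu>)}. sum_list (take i lam) \<le> sum_list (take i \<mu>))"

definition exponent_partition :: "mon \<Rightarrow> nat list" where
  "exponent_partition m =
     rev (sort (map (Poly_Mapping.lookup m) (sorted_list_of_set (Poly_Mapping.keys m))))"

text \<open>The truncated subtraction is meant for \<open>mon_degree m + mon_weight m \<le> n\<close>.\<close>

definition mon_partition :: "nat \<Rightarrow> mon \<Rightarrow> nat list" where
  "mon_partition n m =
     map Suc (exponent_partition m) @ replicate (n - mon_degree m - mon_weight m) 1"


section \<open>Specht polynomials\<close>

text \<open>Rows and columns are numbered from 0; the cell \<open>(i, j)\<close> lies in row \<open>i\<close> and column \<open>j\<close>.\<close>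

definition young_diagram :: "nat list \<Rightarrow> (nat \<times> nat) set" where
  "young_diagram lam = {(i, j). i < length lam \<and> j < lam ! i}"

definition specht_poly :: "nat list \<Rightarrow> (nat \<times> nat \<Rightarrow> nat) \<Rightarrow> 'k::comm_ring_1 mpoly" where
  "specht_poly lam T =
     (\<Prod>j\<in>snd ` young_diagram lam.
        \<Prod>(i, i')\<in>{(i, i'). (i, j) \<in> young_diagram lam \<and> (i', j) \<in> young_diagram lam \<and> i < i'}.
          Var (T (i, j)) - Var (T (i', j)))"

definition specht_polys :: "nat \<Rightarrow> nat list \<Rightarrow> 'k::comm_ring_1 mpoly set" where
  "specht_polys n lam = {specht_poly lam T | T. bij_betw T (young_diagram lam) {1..n}}"


section \<open>Modules over the group algebra of the symmetric group\<close>

text \<open>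
  A module over \<open>\<K>[S\<^sub>n]\<close> is a \<open>\<K>\<close>-vector space with a linear action of \<open>S\<^sub>n\<close>.
  As in the library's \<open>module\<close> record, the fields \<open>mult\<close> and \<open>one\<close> are irrelevant.
\<close>

record ('k, 'v) sn_module = "('k, 'v) module" +
  act :: "(nat \<Rightarrow> nat) \<Rightarrow> 'v \<Rightarrow> 'v"

definition sn_submodule ::
    "nat \<Rightarrow> 'v set \<Rightarrow> ('k::field, 'v, 'm) sn_module_scheme \<Rightarrow> bool" where
  "sn_submodule n W U \<longleftrightarrow>
     submodule W (ring_of_type_algebra :: 'k ring) U \<and>
     (\<forall>\<sigma>\<in>carrier (sym_group n). \<forall>x\<in>W. act U \<sigma> x \<in> W)"

definition sn_isomorphic ::
    "nat \<Rightarrow> ('k::field, 'v, 'm) sn_module_scheme \<Rightarrow> ('k, 'w, 'l) sn_module_scheme \<Rightarrow> bool" where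
  "sn_isomorphic n U V \<longleftrightarrow>
     (\<exists>\<phi>\<in>iso (add_monoid U) (add_monoid V).
        (\<forall>c. \<forall>x\<in>carrier U. \<phi> (c \<odot>\<^bsub>U\<^esub> x) = c \<odot>\<^bsub>V\<^esub> \<phi> x) \<and>
        (\<forall>\<sigma>\<in>carrier (sym_group n). \<forall>x\<in>carrier U. \<phi> (act U \<sigma> x) = act V \<sigma> (\<phi> x)))"

definition poly_module :: "nat \<Rightarrow> ('k::field, 'k mpoly) sn_module" where
  "poly_module n =
     \<lparr>carrier = polys n, monoid.mult = (*), monoid.one = 1, ring.zero = 0, ring.add = (+),
      module.smult = scale, act = perm_poly\<rparr>"

text \<open>The operations on cosets are defined as in \<open>rcoset_mult\<close>.\<close>

definition quotient_module :: "nat \<Rightarrow> 'k mpoly set \<Rightarrow> ('k::field, 'k mpoly set) sn_module" where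
  "quotient_module n I =
     \<lparr>carrier = carrier (mpoly_ring n Quot I), monoid.mult = monoid.mult (mpoly_ring n Quot I),
      monoid.one = monoid.one (mpoly_ring n Quot I), ring.zero = ring.zero (mpoly_ring n Quot I),
      ring.add = ring.add (mpoly_ring n Quot I),
      module.smult = (\<lambda>c A. \<Union>a\<in>A. I +>\<^bsub>mpoly_ring n\<^esub> scale c a),
      act = (\<lambda>\<sigma> A. \<Union>a\<in>A. I +>\<^bsub>mpoly_ring n\<^esub> perm_poly \<sigma> a)\<rparr>"

definition specht_module :: "nat \<Rightarrow> nat list \<Rightarrow> ('k::field, 'k mpoly) sn_module" where
  "specht_module n lam =
     poly_module n \<lparr>carrier :=
       {\<Sum>p\<in>F. scale (c p) p | F c. finite F \<and> F \<subseteq> specht_polys n lam}\<rparr>"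

text \<open>The sum of a family of submodules consists of the finite sums of their elements.\<close>

definition isotypic_component ::
    "nat \<Rightarrow> nat list \<Rightarrow> ('k::field, 'v, 'm) sn_module_scheme \<Rightarrow> 'v set" where
  "isotypic_component n lam U =
     {\<Oplus>\<^bsub>U\<^esub>W\<in>\<W>. f W | \<W> f. finite \<W> \<and>
        (\<forall>W\<in>\<W>. sn_submodule n W U \<and>
                 sn_isomorphic n (U\<lparr>carrier := W\<rparr>) (specht_module n lam :: ('k, 'k mpoly) sn_module) \<and>
                 f W \<in> W)}"

end

theory Submission
  imports Defs
begin

text \<open>
Let \<open>T\<close> be a tableau of shape \<open>\<lambda>\<close>, and call a polynomial antisymmetric for \<open>T\<close> if the column stabilizer of \<open>T\<close> acts
on it by the sign. The theorem follows from the claim that \<open>I\<close> contains every polynomial that is antisymmetric for a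
tableau of shape \<open>\<lambda>\<close>.

Indeed, the Specht module is spanned by the Specht polynomials, and each of them is antisymmetric for its tableau. A
submodule of \<open>\<K>[X\<^sub>1, \<dots>, X\<^sub>n]\<close> that is isomorphic to the Specht module is therefore spanned by antisymmetric
polynomials, and so lies in \<open>I\<close> (\<open>specht_submodule_subset\<close>). In the quotient, such a submodule is spanned by
classes on which the column stabilizers act by the sign; averaging over the stabilizer lifts each such class to an antisymmetric
polynomial, which lies in \<open>I\<close>, so that the submodule is zero (\<open>quotient_submodule_trivial\<close>).

For the claim, every antisymmetric polynomial is a multiple of the product \<open>D\<close> of the Vandermonde products of the columns
(\<open>antisym_polys_vdm_dvd\<close>), and in the degree of \<open>D\<close> an antisymmetric polynomial is determined by one coefficient
(\<open>antisym_eq_0\<close>). Hence the claim holds for \<open>T\<close> as soon as \<open>I\<close> contains a polynomial of at most that degree whose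
antisymmetrization is nonzero at this coefficient (\<open>antisym_polys_subsetI\<close>). This is used twice.

First let the columns of \<open>T\<close> have the lengths \<open>\<mu>(m)\<close>, that is, \<open>T\<close> has shape \<open>\<mu>(m)\<^sup>\<bottom>\<close>. The bound on the degree and
the weight leaves room to permute \<open>P\<close> so that the variables of \<open>P\<^sub>d\<close> lie in different columns, the one with exponent
\<open>k\<close> in \<open>m\<close> in a column of length \<open>k + 1\<close>. Multiplying by a monomial that puts the exponents \<open>0, \<dots>, k - 1\<close> on the other
variables of these columns yields a polynomial of the right degree, and only the monomial \<open>m\<close> contributes to the
coefficient (\<open>antisym_polys_subset_transversal\<close>).

Secondly, if a box moves from a column to a shorter one and the claim holds for the resulting tableau, it holds for
the original one (\<open>antisym_polys_subset_move\<close>). Dominance \<open>\<lambda> \<unlhd> \<mu>(m)\<^sup>\<bottom>\<close> means that the column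
lengths of \<open>\<lambda>\<close> dominate \<open>\<mu>(m)\<close> (\<open>conjugate_dominance\<close>), so finitely many such moves lead from a tableau of
shape \<open>\<lambda>\<close> to the first case (\<open>antisym_polys_subset_dominating\<close>).
\<close>

abbreviation "lookup \<equiv> Poly_Mapping.lookup"
abbreviation "keys \<equiv> Poly_Mapping.keys"
abbreviation "single \<equiv> Poly_Mapping.single"

section \<open>Renaming the variables of a polynomial\<close>

text \<open>
Extended additively from \<open>X\<^sub>j \<mapsto> X\<^bsub>\<sigma> j\<^esub>\<close>, for an arbitrary map \<open>\<sigma>\<close>: besides permutations, the
map that sends one variable to another is needed for the divisibility argument below.
\<close>

definition mon_map :: "(nat \<Rightarrow> nat) \<Rightarrow> mon \<Rightarrow> mon" where
  "mon_map \<sigma> m = (\<Sum>j\<in>keys m. single (\<sigma> j) (lookup m j))"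

lemma mon_map_superset:
  assumes "finite S" "keys m \<subseteq> S"
  shows "mon_map \<sigma> m = (\<Sum>j\<in>S. single (\<sigma> j) (lookup m j))"
  unfolding mon_map_def
  by (rule sum.mono_neutral_left) (use assms in \<open>auto simp: in_keys_iff\<close>)

lemma mon_map_0 [simp]: "mon_map \<sigma> 0 = 0"
  by (simp add: mon_map_def)

lemma mon_map_single [simp]: "mon_map \<sigma> (single j k) = single (\<sigma> j) k"
  by (subst mon_map_superset[where S = "{j}"]) (auto split: if_splits)

lemma mon_map_add: "mon_map \<sigma> (a + b) = mon_map \<sigma> a + mon_map \<sigma> b"
proof -
  have "keys (a + b) \<subseteq> keys a \<union> keys b" by (rule Poly_Mapping.keys_add)
  then show ?thesis
    by (simp add: mon_map_superset[where S = "keys a \<union> keys b"] lookup_add single_add sum.distrib)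
qed

lemma mon_map_sum: "mon_map \<sigma> (sum f S) = (\<Sum>x\<in>S. mon_map \<sigma> (f x))"
  by (induction S rule: infinite_finite_induct) (simp_all add: mon_map_add)

lemma mon_map_comp: "mon_map \<sigma> (mon_map \<tau> m) = mon_map (\<sigma> \<circ> \<tau>) m"
  by (simp add: mon_map_def[of \<tau>] mon_map_def[of "\<sigma> \<circ> \<tau>"] mon_map_sum)

lemma poly_mapping_sum_singles: "p = (\<Sum>m\<in>keys p. single m (lookup p m))"
proof (rule poly_mapping_eqI)
  fix k
  have "lookup (\<Sum>m\<in>keys p. single m (lookup p m)) k = (\<Sum>m\<in>keys p. if m = k then lookup p m else 0)"
    by (simp add: lookup_sum lookup_single when_def)
  then show "lookup p k = lookup (\<Sum>m\<in>keys p. single m (lookup p m)) k"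
    by (simp add: in_keys_iff)
qed

lemma mon_map_id [simp]: "mon_map id m = m" "mon_map (\<lambda>x. x) m = m"
  using poly_mapping_sum_singles[of m] by (simp_all add: mon_map_def)

lemma lookup_mon_map:
  assumes "bij \<sigma>"
  shows "lookup (mon_map \<sigma> m) j = lookup m (inv' \<sigma> j)"
proof -
  have "lookup (mon_map \<sigma> m) j = (\<Sum>i\<in>keys m. if i = inv' \<sigma> j then lookup m i else 0)"
    unfolding mon_map_def lookup_sum lookup_single when_def
    by (rule sum.cong) (use assms in \<open>auto simp: bij_def inv_f_f surj_f_inv_f\<close>)
  then show ?thesis by (simp add: in_keys_iff)
qed

lemma keys_mon_map: "keys (mon_map \<sigma> m) \<subseteq> \<sigma> ` keys m"
proof -
  have "keys (mon_map \<sigma> m) \<subseteq> (\<Union>j\<in>keys m. keys (single (\<sigma> j) (lookup m j)))"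
    unfolding mon_map_def by (rule keys_sum)
  then show ?thesis by auto
qed

lemma mon_degree_superset:
  assumes "finite S" "keys m \<subseteq> S"
  shows "mon_degree m = (\<Sum>j\<in>S. lookup m j)"
  unfolding mon_degree_def
  by (rule sum.mono_neutral_left) (use assms in \<open>auto simp: in_keys_iff\<close>)

lemma mon_degree_0 [simp]: "mon_degree 0 = 0"
  by (simp add: mon_degree_def)

lemma mon_degree_single [simp]: "mon_degree (single j k) = k"
  by (subst mon_degree_superset[where S = "{j}"]) (auto split: if_splits)

lemma mon_degree_add: "mon_degree (a + b) = mon_degree a + mon_degree b"
proof -
  have "keys (a + b) \<subseteq> keys a \<union> keys b" by (rule Poly_Mapping.keys_add)
  then show ?thesis
    by (simp add: mon_degree_superset[where S = "keys a \<union> keys b"] lookup_add sum.distrib)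
qed

lemma mon_degree_sum: "mon_degree (sum f S) = (\<Sum>x\<in>S. mon_degree (f x))"
  by (induction S rule: infinite_finite_induct) (simp_all add: mon_degree_add)

lemma mon_degree_mon_map [simp]: "mon_degree (mon_map \<sigma> m) = mon_degree m"
  by (simp add: mon_map_def mon_degree_sum) (simp add: mon_degree_def)

lemma lookup_single_mult:
  fixes p :: "'k::comm_ring_1 mpoly"
  shows "lookup (single a c * p) (a + b) = c * lookup p b"
proof -
  have "single a c * p = (\<Sum>m\<in>keys p. single (a + m) (c * lookup p m))"
    by (subst poly_mapping_sum_singles[of p]) (simp add: sum_distrib_left mult_single)
  then have "lookup (single a c * p) (a + b) = (\<Sum>m\<in>keys p. if m = b then c * lookup p m else 0)"
    by (simp add: lookup_sum lookup_single when_def)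
  then show ?thesis by (simp add: in_keys_iff)
qed

lemma lookup_Const_mult [simp]:
  fixes p :: "'k::comm_ring_1 mpoly"
  shows "lookup (Const c * p) m = c * lookup p m"
  using lookup_single_mult[of 0 c p m] by (simp add: Const_def)

lemma lookup_scale [simp]: "lookup (scale c p) m = c * lookup p m"
  by (simp add: scale_def)

lemma scale_eq_of_int: "scale (of_int k) p = of_int k * p"
  by (rule poly_mapping_eqI) (simp add: scale_def Const_def)

lemma Var_power: "Var i ^ k = (single (single i k) 1 :: 'k::comm_ring_1 mpoly)"
  by (induction k) (simp_all add: Var_def mult_single single_add[symmetric] del: single_one, simp)

lemma prod_single_one:
  "(\<Prod>x\<in>S. single (f x) 1) = (single (\<Sum>x\<in>S. f x) 1 :: 'k::comm_ring_1 mpoly)"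
  by (induction S rule: infinite_finite_induct) (simp_all add: mult_single)

lemma perm_poly_eq: "perm_poly \<sigma> p = (\<Sum>m\<in>keys p. single (mon_map \<sigma> m) (lookup p m))"
  unfolding perm_poly_def mon_map_def
  by (simp add: Var_power prod_single_one Const_def mult_single)

lemma perm_poly_superset:
  assumes "finite S" "keys p \<subseteq> S"
  shows "perm_poly \<sigma> p = (\<Sum>m\<in>S. single (mon_map \<sigma> m) (lookup p m))"
  unfolding perm_poly_eq
  by (rule sum.mono_neutral_left) (use assms in \<open>auto simp: in_keys_iff\<close>)

lemma perm_poly_0 [simp]: "perm_poly \<sigma> 0 = 0"
  by (simp add: perm_poly_eq)

lemma perm_poly_single [simp]: "perm_poly \<sigma> (single m c) = single (mon_map \<sigma> m) c"
  by (subst perm_poly_superset[where S = "{m}"]) (auto split: if_splits)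

lemma perm_poly_1 [simp]: "perm_poly \<sigma> 1 = 1"
  using perm_poly_single[of \<sigma> 0 1] by simp

lemma perm_poly_add: "perm_poly \<sigma> (p + q) = perm_poly \<sigma> p + perm_poly \<sigma> q"
proof -
  have "keys (p + q) \<subseteq> keys p \<union> keys q" by (rule Poly_Mapping.keys_add)
  then show ?thesis
    by (simp add: perm_poly_superset[where S = "keys p \<union> keys q"] lookup_add single_add sum.distrib)
qed

lemma perm_poly_sum: "perm_poly \<sigma> (sum f S) = (\<Sum>x\<in>S. perm_poly \<sigma> (f x))"
  by (induction S rule: infinite_finite_induct) (simp_all add: perm_poly_add)

lemma mult_sum_singles:
  "(\<Sum>a\<in>S. single (f a) (g a)) * (\<Sum>b\<in>T. single (f' b) (g' b)) =
   (\<Sum>a\<in>S. \<Sum>b\<in>T. single (f a + f' b :: mon) (g a * g' b :: 'k::comm_ring_1))"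
  by (simp only: sum_product mult_single)

text \<open>
Together with additivity this makes \<open>perm_poly \<sigma>\<close> a ring homomorphism for every map \<open>\<sigma>\<close>; when \<open>\<sigma>\<close>
merges two variables it is the substitution of one variable for the other.
\<close>

lemma perm_poly_mult: "perm_poly \<sigma> (p * q) = perm_poly \<sigma> p * perm_poly \<sigma> q"
proof -
  have "p * q = (\<Sum>a\<in>keys p. single a (lookup p a)) * (\<Sum>b\<in>keys q. single b (lookup q b))"
    by (simp flip: poly_mapping_sum_singles)
  then show ?thesis
    by (simp add: mult_sum_singles perm_poly_sum mon_map_add perm_poly_eq[of _ p] perm_poly_eq[of _ q])
qed

lemma perm_poly_uminus: "perm_poly \<sigma> (- p) = - perm_poly \<sigma> p"
  by (metis add.inverse_inverse add_eq_0_iff perm_poly_0 perm_poly_add)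

lemma perm_poly_diff: "perm_poly \<sigma> (p - q) = perm_poly \<sigma> p - perm_poly \<sigma> q"
  using perm_poly_add[of \<sigma> p "- q"] by (simp add: perm_poly_uminus)

lemma perm_poly_prod: "perm_poly \<sigma> (prod f S) = (\<Prod>x\<in>S. perm_poly \<sigma> (f x))"
  by (induction S rule: infinite_finite_induct) (simp_all add: perm_poly_mult)

lemma perm_poly_Var [simp]: "perm_poly \<sigma> (Var i) = Var (\<sigma> i)"
  by (simp add: Var_def)

lemma perm_poly_of_int [simp]: "perm_poly \<sigma> (of_int k) = of_int k"
  by (metis mon_map_0 perm_poly_single single_of_int)

lemma perm_poly_comp: "perm_poly \<sigma> (perm_poly \<tau> p) = perm_poly (\<sigma> \<circ> \<tau>) p"
  by (simp add: perm_poly_eq[of \<tau>] perm_poly_eq[of "\<sigma> \<circ> \<tau>"] perm_poly_sum mon_map_comp)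

lemma perm_poly_id [simp]: "perm_poly id p = p" "perm_poly (\<lambda>x. x) p = p"
  using poly_mapping_sum_singles[of p] by (simp_all add: perm_poly_eq)

lemma mon_map_inv:
  assumes "bij \<sigma>"
  shows "mon_map (inv' \<sigma>) (mon_map \<sigma> m) = m" "mon_map \<sigma> (mon_map (inv' \<sigma>) m) = m"
  using assms by (simp_all add: mon_map_comp bij_is_inj surj_iff[THEN iffD1, OF bij_is_surj])

lemma lookup_perm_poly:
  assumes "bij \<sigma>"
  shows "lookup (perm_poly \<sigma> p) (mon_map \<sigma> m) = lookup p m"
proof -
  have inj: "mon_map \<sigma> a = mon_map \<sigma> b \<longleftrightarrow> a = b" for a b
    using mon_map_inv[OF assms] by metis
  have "lookup (perm_poly \<sigma> p) (mon_map \<sigma> m) = (\<Sum>a\<in>keys p. if a = m then lookup p a else 0)"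
    by (simp add: perm_poly_eq lookup_sum lookup_single when_def inj)
  then show ?thesis by (simp add: in_keys_iff)
qed

lemma keys_perm_poly: "keys (perm_poly \<sigma> p) \<subseteq> mon_map \<sigma> ` keys p"
proof -
  have "keys (perm_poly \<sigma> p) \<subseteq> (\<Union>m\<in>keys p. keys (single (mon_map \<sigma> m) (lookup p m)))"
    unfolding perm_poly_eq by (rule keys_sum)
  then show ?thesis by auto
qed

section \<open>Closure properties of the polynomial ring\<close>

lemma polysD: "p \<in> polys n \<Longrightarrow> m \<in> keys p \<Longrightarrow> keys m \<subseteq> {1..n}"
  by (auto simp: polys_def)

lemma polys_0 [simp]: "0 \<in> polys n" and polys_1 [simp]: "1 \<in> polys n"
  by (auto simp: polys_def)

lemma polys_single: "keys m \<subseteq> {1..n} \<Longrightarrow> single m c \<in> polys n"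
  by (auto simp: polys_def split: if_splits)

lemma polys_Const [simp]: "Const c \<in> polys n"
  by (simp add: Const_def polys_single)

lemma polys_of_int [simp]: "of_int k \<in> polys n"
  by (metis keys_zero empty_subsetI polys_single single_of_int)

lemma polys_Var: "i \<in> {1..n} \<Longrightarrow> Var i \<in> polys n"
  by (simp add: Var_def polys_single)

lemma polys_add: "p \<in> polys n \<Longrightarrow> q \<in> polys n \<Longrightarrow> p + q \<in> polys n"
  using Poly_Mapping.keys_add[of p q] by (auto simp: polys_def dest!: subsetD)

lemma polys_mult: "p \<in> polys n \<Longrightarrow> q \<in> polys n \<Longrightarrow> p * q \<in> polys n"
  using cring.cring_simprules(5)[OF cring_mpoly_ring[of n], of p q] by (simp add: mpoly_ring_def)

lemma polys_uminus: "p \<in> polys n \<Longrightarrow> - p \<in> polys n"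
  by (simp add: polys_def)

lemma polys_diff: "p \<in> polys n \<Longrightarrow> q \<in> polys n \<Longrightarrow> p - q \<in> polys n"
  using polys_add[of p n "- q"] by (simp add: polys_uminus)

lemma polys_sum: "(\<And>x. x \<in> S \<Longrightarrow> f x \<in> polys n) \<Longrightarrow> sum f S \<in> polys n"
  by (induction S rule: infinite_finite_induct) (simp_all add: polys_add)

lemma polys_prod: "(\<And>x. x \<in> S \<Longrightarrow> f x \<in> polys n) \<Longrightarrow> prod f S \<in> polys n"
  by (induction S rule: infinite_finite_induct) (simp_all add: polys_mult)

lemma polys_scale: "p \<in> polys n \<Longrightarrow> scale c p \<in> polys n"
  by (simp add: scale_def polys_mult)

lemma polys_perm_poly:
  assumes "\<sigma> ` {1..n} \<subseteq> {1..n}" "p \<in> polys n"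
  shows "perm_poly \<sigma> p \<in> polys n"
  unfolding polys_def
proof (clarify del: subsetI)
  fix m assume "m \<in> keys (perm_poly \<sigma> p)"
  then obtain a where "a \<in> keys p" "m = mon_map \<sigma> a" using keys_perm_poly by blast
  then show "keys m \<subseteq> {1..n}" using keys_mon_map[of \<sigma> a] polysD[OF assms(2)] assms(1) by blast
qed

section \<open>Degree bounds\<close>

definition deg_le :: "nat \<Rightarrow> 'k::comm_ring_1 mpoly \<Rightarrow> bool" where
  "deg_le N p \<longleftrightarrow> (\<forall>m\<in>keys p. mon_degree m \<le> N)"

lemma deg_le_mult:
  assumes "deg_le M p" "deg_le N q"
  shows "deg_le (M + N) (p * q)"
  unfolding deg_le_def
proof
  fix m assume "m \<in> keys (p * q)"
  then obtain a b where "m = a + b" "a \<in> keys p" "b \<in> keys q" using keys_mult[of p q] by blast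
  then show "mon_degree m \<le> M + N" using assms by (simp add: deg_le_def mon_degree_add add_mono)
qed

lemma deg_le_diff:
  assumes "deg_le N p" "deg_le N q"
  shows "deg_le N (p - q)"
  using assms keys_diff[of p q] by (auto simp: deg_le_def)

lemma deg_le_single: "mon_degree m \<le> N \<Longrightarrow> deg_le N (single m c)"
  by (simp add: deg_le_def)

lemma deg_le_sum: "(\<And>x. x \<in> S \<Longrightarrow> deg_le N (f x)) \<Longrightarrow> deg_le N (sum f S)"
  using keys_sum[of f S] by (fastforce simp: deg_le_def)

lemma deg_le_prod:
  assumes "finite S" "\<And>x. x \<in> S \<Longrightarrow> deg_le 1 (f x)"
  shows "deg_le (card S) (prod f S)"
  using assms
proof (induction S rule: finite_induct)
  case empty
  then show ?case by (simp add: deg_le_def)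
next
  case (insert x F)
  then have "deg_le (1 + card F) (f x * prod f F)" by (intro deg_le_mult) auto
  then show ?case using insert by simp
qed

lemma deg_le_Const_mult: "deg_le N p \<Longrightarrow> deg_le N (Const c * p)"
  using deg_le_mult[of 0 "Const c" N p] by (auto simp: Const_def deg_le_single)

lemma deg_le_perm_poly: "deg_le N p \<Longrightarrow> deg_le N (perm_poly \<sigma> p)"
  using keys_perm_poly[of \<sigma> p] by (fastforce simp: deg_le_def)

section \<open>Column groups and antisymmetric polynomials\<close>

text \<open>
A filling of a Young diagram is encoded by the function \<open>c\<close> that maps each number to the index of
its column; moving a box to another column is then a function update. In this encoding the group
below is the column stabilizer of the filling.
\<close>

definition col_group :: "nat \<Rightarrow> (nat \<Rightarrow> nat) \<Rightarrow> (nat \<Rightarrow> nat) set" where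
  "col_group n c = {\<sigma>. \<sigma> permutes {1..n} \<and> (\<forall>x. c (\<sigma> x) = c x)}"

definition antisym_polys :: "nat \<Rightarrow> (nat \<Rightarrow> nat) \<Rightarrow> 'k::comm_ring_1 mpoly set" where
  "antisym_polys n c = {w \<in> polys n. \<forall>\<sigma>\<in>col_group n c. perm_poly \<sigma> w = of_int (sign \<sigma>) * w}"

lemma col_group_permutes: "\<sigma> \<in> col_group n c \<Longrightarrow> \<sigma> permutes {1..n}"
  and col_group_eq: "\<sigma> \<in> col_group n c \<Longrightarrow> c (\<sigma> x) = c x"
  by (auto simp: col_group_def)

lemma finite_col_group: "finite (col_group n c)"
  by (rule finite_subset[OF _ finite_permutations[of "{1..n}"]]) (auto simp: col_group_def)

lemma id_in_col_group: "id \<in> col_group n c"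
  by (simp add: col_group_def permutes_id)

lemma col_group_comp: "\<sigma> \<in> col_group n c \<Longrightarrow> \<tau> \<in> col_group n c \<Longrightarrow> \<sigma> \<circ> \<tau> \<in> col_group n c"
  by (simp add: col_group_def permutes_compose)

lemma col_group_inv: "\<sigma> \<in> col_group n c \<Longrightarrow> inv' \<sigma> \<in> col_group n c"
  by (auto simp: col_group_def permutes_inv) (metis permutes_inverses(1))

lemma col_group_bij: "\<sigma> \<in> col_group n c \<Longrightarrow> bij \<sigma>"
  using permutes_bij by (auto simp: col_group_def)

lemma col_group_permutation: "\<sigma> \<in> col_group n c \<Longrightarrow> permutation \<sigma>"
  unfolding permutation_permutes using col_group_permutes by blast

lemma transpose_in_col_group:
  "x \<in> {1..n} \<Longrightarrow> y \<in> {1..n} \<Longrightarrow> c x = c y \<Longrightarrow> transpose x y \<in> col_group n c"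
  by (simp add: col_group_def permutes_swap_id transpose_def)

text \<open>
The column group is generated by the transpositions within columns: if \<open>\<sigma>\<close> moves \<open>x\<close>, composing it
with the transposition of \<open>x\<close> and \<open>\<sigma> x\<close> creates the new fixed point \<open>x\<close> and keeps the old ones.
\<close>

lemma col_group_induct [consumes 1, case_names id transpose]:
  assumes "\<sigma> \<in> col_group n c" and "P id"
    and step: "\<And>x y \<sigma>. \<sigma> \<in> col_group n c \<Longrightarrow> x \<in> {1..n} \<Longrightarrow> y \<in> {1..n} \<Longrightarrow> x \<noteq> y \<Longrightarrow> c x = c y \<Longrightarrow>
      P \<sigma> \<Longrightarrow> P (transpose x y \<circ> \<sigma>)"
  shows "P \<sigma>"
  using assms(1)
proof (induction "card {x. \<sigma> x \<noteq> x}" arbitrary: \<sigma> rule: less_induct)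
  case less
  show ?case
  proof (cases "\<sigma> = id")
    case True
    then show ?thesis using assms(2) by simp
  next
    case False
    then obtain x where x: "\<sigma> x \<noteq> x" by (auto simp: fun_eq_iff)
    have perm: "\<sigma> permutes {1..n}" using less.prems by (rule col_group_permutes)
    have xn: "x \<in> {1..n}" using perm x by (meson permutes_not_in)
    have sxn: "\<sigma> x \<in> {1..n}" using perm xn by (simp only: permutes_in_image)
    have cc: "c x = c (\<sigma> x)" using less.prems by (simp add: col_group_eq)
    define \<tau> where "\<tau> = transpose x (\<sigma> x) \<circ> \<sigma>"
    have \<tau>: "\<tau> \<in> col_group n c"
      unfolding \<tau>_def using xn sxn cc less.prems by (intro col_group_comp transpose_in_col_group)
    have sub: "{z. \<tau> z \<noteq> z} \<subset> {z. \<sigma> z \<noteq> z}"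
    proof
      show "{z. \<tau> z \<noteq> z} \<subseteq> {z. \<sigma> z \<noteq> z}"
      proof clarify
        fix z assume z: "\<tau> z \<noteq> z" "\<sigma> z = z"
        then have "z \<noteq> x" using x by auto
        moreover have "z \<noteq> \<sigma> x"
          using z(2) \<open>z \<noteq> x\<close> permutes_inj[OF perm] by (metis injD)
        ultimately show False using z by (simp add: \<tau>_def transpose_def)
      qed
      show "{z. \<tau> z \<noteq> z} \<noteq> {z. \<sigma> z \<noteq> z}"
        using x by (auto simp: \<tau>_def transpose_def set_eq_iff intro!: exI[of _ x])
    qed
    have "finite {z. \<sigma> z \<noteq> z}"
      by (rule finite_subset[of _ "{1..n}"]) (use perm permutes_not_in in fastforce)+
    then have "card {z. \<tau> z \<noteq> z} < card {z. \<sigma> z \<noteq> z}" using sub by (rule psubset_card_mono)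
    then have "P \<tau>" using less.hyps \<tau> by blast
    then have "P (transpose x (\<sigma> x) \<circ> \<tau>)" using step \<tau> xn sxn x cc by metis
    moreover have "transpose x (\<sigma> x) \<circ> \<tau> = \<sigma>" by (simp add: \<tau>_def fun_eq_iff)
    ultimately show ?thesis by simp
  qed
qed

lemma antisym_polysI:
  assumes "w \<in> polys n"
    and tr: "\<And>x y. x \<in> {1..n} \<Longrightarrow> y \<in> {1..n} \<Longrightarrow> x \<noteq> y \<Longrightarrow> c x = c y \<Longrightarrow> perm_poly (transpose x y) w = - w"
  shows "w \<in> antisym_polys n c"
proof -
  have "perm_poly \<sigma> w = of_int (sign \<sigma>) * w" if "\<sigma> \<in> col_group n c" for \<sigma>
    using that
  proof (induction rule: col_group_induct)
    case id
    then show ?case by simp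
  next
    case (transpose x y \<sigma>)
    have "perm_poly (Transposition.transpose x y \<circ> \<sigma>) w = of_int (sign \<sigma>) * perm_poly (Transposition.transpose x y) w"
      by (simp add: transpose.IH perm_poly_mult flip: perm_poly_comp)
    moreover have "sign (Transposition.transpose x y \<circ> \<sigma>) = - sign \<sigma>"
      using transpose col_group_permutation
      by (simp add: sign_compose permutation_swap_id sign_swap_id)
    ultimately have "perm_poly (Transposition.transpose x y \<circ> \<sigma>) w = of_int (sign (Transposition.transpose x y \<circ> \<sigma>)) * w"
      using tr[OF transpose(2-5)] by (simp del: o_apply)
    then show ?case by (simp only: o_def)
  qed
  then show ?thesis using assms(1) by (simp add: antisym_polys_def)
qed

lemma antisym_polys_transpose:
  assumes "w \<in> antisym_polys n c" "x \<in> {1..n}" "y \<in> {1..n}" "x \<noteq> y" "c x = c y"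
  shows "perm_poly (transpose x y) w = - w"
  using assms transpose_in_col_group[of x n y c] by (simp add: antisym_polys_def sign_swap_id)

section \<open>Antisymmetric polynomials are multiples of Vandermonde products\<close>

lemma eq_uminus_imp_0: "p = - p \<Longrightarrow> p = (0 :: 'k::field_char_0 mpoly)"
proof -
  assume "p = - p"
  then have "lookup p m = - lookup p m" for m by (metis lookup_uminus)
  then show "p = 0" by (intro poly_mapping_eqI) simp
qed

text \<open>
Substituting \<open>X\<^sub>y\<close> for \<open>X\<^sub>x\<close> is the ring homomorphism whose kernel is generated by
\<open>X\<^sub>x - X\<^sub>y\<close>; it is given by renaming along this map.
\<close>

definition merge :: "nat \<Rightarrow> nat \<Rightarrow> nat \<Rightarrow> nat" where
  "merge x y = id(x := y)"

abbreviation collapse :: "nat \<Rightarrow> nat \<Rightarrow> 'k::comm_ring_1 mpoly \<Rightarrow> 'k mpoly" where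
  "collapse x y \<equiv> perm_poly (merge x y)"

lemma collapse_transpose: "collapse x y (perm_poly (transpose x y) p) = collapse x y p"
proof -
  have "merge x y \<circ> transpose x y = merge x y" by (auto simp: fun_eq_iff transpose_def merge_def)
  then show ?thesis by (simp add: perm_poly_comp)
qed

lemma collapse_eq_0:
  fixes w :: "'k::field_char_0 mpoly"
  assumes "perm_poly (transpose x y) w = - w"
  shows "collapse x y w = 0"
  using collapse_transpose[of x y w] assms by (intro eq_uminus_imp_0) (simp add: perm_poly_uminus)

text \<open>
For a single monomial this is the factorization of \<open>X\<^sub>x\<^sup>k - X\<^sub>y\<^sup>k\<close>. The lemma
describes the kernel of \<open>collapse x y\<close>, and it keeps track of the quotient staying in the variables \<open>1..n\<close>.
\<close>

lemma Var_diff_dvd_diff_collapse: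
  assumes "p \<in> polys n" "x \<in> {1..n}" "y \<in> {1..n}"
  shows "\<exists>r\<in>polys n. p - collapse x y p = (Var x - Var y) * r"
proof -
  let ?ok = "\<lambda>p. \<exists>r\<in>polys n. p - collapse x y p = (Var x - Var y) * r"
  have single: "?ok (single m c)" if m: "keys m \<subseteq> {1..n}" for m and c :: 'a
  proof -
    \<comment> \<open>Split off the power of the variable \<open>x\<close>; the cofactor \<open>m'\<close> is not affected by the substitution.\<close>
    define k m' where "k = lookup m x" and "m' = m - single x k"
    have keys': "keys m' \<subseteq> keys m" "x \<notin> keys m'"
      by (auto simp: m'_def k_def in_keys_iff lookup_minus lookup_single when_def)
    have mm: "m = single x k + m'"
      by (rule poly_mapping_eqI) (simp add: m'_def k_def lookup_add lookup_minus lookup_single when_def)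
    have m'': "mon_map (merge x y) m' = m'"
    proof -
      have "mon_map (merge x y) m' = (\<Sum>j\<in>keys m'. single j (lookup m' j))"
        unfolding mon_map_def using keys'(2) by (intro sum.cong) (auto simp: merge_def)
      then show ?thesis by (simp flip: poly_mapping_sum_singles)
    qed
    have *: "Var i ^ k * single m' c = single (single i k + m') c" for i
      by (simp add: Var_power mult_single)
    have "single m c - collapse x y (single m c) = (Var x ^ k - Var y ^ k) * single m' c"
      by (simp add: left_diff_distrib *) (simp add: mm mon_map_add m'', simp add: merge_def)
    also have "\<dots> = (Var x - Var y) * ((\<Sum>i<k. Var y ^ (k - Suc i) * Var x ^ i) * single m' c)"
      by (simp add: power_diff_sumr2 mult.assoc)
    finally have eq: "single m c - collapse x y (single m c) = \<dots>" .
    have "(\<Sum>i<k. Var y ^ (k - Suc i) * Var x ^ i) * (single m' c :: 'a mpoly) \<in> polys n"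
      unfolding Var_power
      by (intro polys_mult polys_sum polys_single) (use assms m keys' in \<open>auto split: if_splits\<close>)
    then show ?thesis using eq by blast
  qed
  have "?ok (\<Sum>m\<in>S. single m (lookup p m))" if "finite S" "S \<subseteq> keys p" for S
    using that
  proof (induction S rule: finite_induct)
    case empty
    then show ?case by (auto intro!: bexI[of _ 0])
  next
    case (insert m S)
    then obtain r where r: "r \<in> polys n"
      "(\<Sum>m\<in>S. single m (lookup p m)) - collapse x y (\<Sum>m\<in>S. single m (lookup p m)) = (Var x - Var y) * r"
      by auto
    obtain s where s: "s \<in> polys n"
      "single m (lookup p m) - collapse x y (single m (lookup p m)) = (Var x - Var y) * s"
      using single polysD[OF assms(1)] insert.prems by blast
    have "s + r \<in> polys n" using r s by (simp add: polys_add)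
    moreover have "(\<Sum>m\<in>insert m S. single m (lookup p m)) - collapse x y (\<Sum>m\<in>insert m S. single m (lookup p m))
        = (Var x - Var y) * (s + r)"
      by (simp only: sum.insert[OF insert(1,2)] perm_poly_add add_diff_add r(2) s(2) distrib_left)
    ultimately show ?case by blast
  qed
  from this[of "keys p"] show ?thesis by (simp flip: poly_mapping_sum_singles)
qed

text \<open>
An orientation of the graph that joins any two different numbers of the same column. The rows of a
tableau orient it in one way, the exponents of a suitable monomial in another; allowing all
orientations avoids tracking the sign by which the resulting products differ.
\<close>

definition orients :: "nat \<Rightarrow> (nat \<Rightarrow> nat) \<Rightarrow> (nat \<times> nat) set \<Rightarrow> bool" where
  "orients n c S \<longleftrightarrow>
     S \<union> S\<inverse> = {(u, v). u \<in> {1..n} \<and> v \<in> {1..n} \<and> u \<noteq> v \<and> c u = c v} \<and> S \<inter> S\<inverse> = {}"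

text \<open>
For an orientation of the columns this is, up to sign, the product of the Vandermonde determinants
of the columns, that is, a Specht polynomial.
\<close>

definition vdm :: "(nat \<times> nat) set \<Rightarrow> 'k::comm_ring_1 mpoly" where
  "vdm S = (\<Prod>(u, v)\<in>S. Var u - Var v)"

lemma orientsD:
  assumes "orients n c S" "(u, v) \<in> S"
  shows "u \<in> {1..n}" "v \<in> {1..n}" "u \<noteq> v" "c u = c v" "(v, u) \<notin> S"
proof -
  have "(u, v) \<in> S \<union> S\<inverse>" using assms(2) by (rule UnI1)
  also have "S \<union> S\<inverse> = {(u, v). u \<in> {1..n} \<and> v \<in> {1..n} \<and> u \<noteq> v \<and> c u = c v}"
    using assms(1) unfolding orients_def by (rule conjunct1)
  finally show "u \<in> {1..n}" "v \<in> {1..n}" "u \<noteq> v" "c u = c v" by simp_all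
  have "S \<inter> S\<inverse> = {}" using assms(1) unfolding orients_def by (rule conjunct2)
  then show "(v, u) \<notin> S" using assms(2) by blast
qed

lemma orientsD':
  assumes "orients n c S" "u \<in> {1..n}" "v \<in> {1..n}" "u \<noteq> v" "c u = c v"
  shows "(u, v) \<in> S \<or> (v, u) \<in> S"
proof -
  have "(u, v) \<in> {(u, v). u \<in> {1..n} \<and> v \<in> {1..n} \<and> u \<noteq> v \<and> c u = c v}" using assms by simp
  also have "\<dots> = S \<union> S\<inverse>"
    using assms(1) unfolding orients_def by (simp only:)
  finally show ?thesis by simp
qed

lemma orients_finite: "orients n c S \<Longrightarrow> finite S"
  by (rule finite_subset[of _ "{1..n} \<times> {1..n}"]) (auto dest: orientsD)

lemma Var_eq_iff: "(Var u :: 'k::comm_ring_1 mpoly) = Var v \<longleftrightarrow> u = v"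
proof
  assume "(Var u :: 'k mpoly) = Var v"
  then have "keys (Var u :: 'k mpoly) = keys (Var v :: 'k mpoly)" by simp
  then have "single u (1::nat) = single v 1" by (simp add: Var_def)
  then have "keys (single u (1::nat)) = keys (single v (1::nat))" by simp
  then show "u = v" by simp
qed simp

lemma vdm_neq_0:
  assumes "finite S" "\<And>u v. (u, v) \<in> S \<Longrightarrow> u \<noteq> v"
  shows "(vdm S :: 'k::field_char_0 mpoly) \<noteq> 0"
  unfolding vdm_def using assms by (auto simp: prod_zero_iff Var_eq_iff)

lemma vdm_polys: "orients n c S \<Longrightarrow> vdm S \<in> polys n"
  unfolding vdm_def by (intro polys_prod) (auto intro!: polys_diff polys_Var dest: orientsD)

lemma deg_le_vdm: "finite S \<Longrightarrow> deg_le (card S) (vdm S)"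
  unfolding vdm_def
  by (intro deg_le_prod) (auto simp: Var_def split_beta intro!: deg_le_diff deg_le_single)

lemma collapse_vdm_neq_0:
  assumes "finite S" "\<And>a b. (a, b) \<in> S \<Longrightarrow> a \<noteq> b \<and> {a, b} \<noteq> {u, v}"
  shows "collapse u v (vdm S :: 'k::field_char_0 mpoly) \<noteq> 0"
proof -
  have "collapse u v (Var a - Var b :: 'k mpoly) \<noteq> 0" if "(a, b) \<in> S" for a b
    using assms(2)[OF that] by (auto simp: perm_poly_diff Var_eq_iff doubleton_eq_iff merge_def)
  then show ?thesis
    unfolding vdm_def perm_poly_prod using assms(1) by (auto simp: prod_zero_iff split_beta)
qed

text \<open>
The factors are removed one at a time. If \<open>w = V q\<close> for a partial product \<open>V\<close> and \<open>X\<^sub>u - X\<^sub>v\<close> is a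
further factor, then \<open>w\<close> vanishes when \<open>X\<^sub>u\<close> is replaced by \<open>X\<^sub>v\<close>, because it changes sign under their transposition.
No factor of \<open>V\<close> vanishes there, so \<open>q\<close> does, and \<open>X\<^sub>u - X\<^sub>v\<close> divides \<open>q\<close>.
\<close>

lemma antisym_polys_vdm_dvd:
  fixes w :: "'k::field_char_0 mpoly"
  assumes w: "w \<in> antisym_polys n c" and S: "orients n c S"
  shows "\<exists>q\<in>polys n. w = vdm S * q"
proof -
  have "\<exists>q\<in>polys n. w = vdm F * q" if "finite F" "F \<subseteq> S" for F
    using that
  proof (induction F rule: finite_induct)
    case empty
    then show ?case using w by (auto simp: vdm_def antisym_polys_def)
  next
    case (insert e F)
    obtain u v where e: "e = (u, v)" by fastforce
    obtain q where q: "q \<in> polys n" "w = vdm F * q" using insert by auto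
    have uv: "u \<in> {1..n}" "v \<in> {1..n}" "u \<noteq> v" "c u = c v" "(v, u) \<notin> S"
      using orientsD[OF S] insert.prems e by auto
    have "collapse u v (vdm F) * collapse u v q = 0"
      using collapse_eq_0[OF antisym_polys_transpose[OF w uv(1-4)]] by (simp add: q perm_poly_mult)
    moreover have "collapse u v (vdm F :: 'k mpoly) \<noteq> 0"
    proof (rule collapse_vdm_neq_0)
      show "finite F" by fact
      show "a \<noteq> b \<and> {a, b} \<noteq> {u, v}" if "(a, b) \<in> F" for a b
        using that insert e uv(5) orientsD(3)[OF S, of a b] by (auto simp: doubleton_eq_iff)
    qed
    ultimately have "collapse u v q = 0" by simp
    then obtain r where "r \<in> polys n" "q = (Var u - Var v) * r"
      using Var_diff_dvd_diff_collapse[OF q(1) uv(1,2)] by auto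
    then show ?case using q(2) insert(1,2) e by (auto simp: vdm_def mult_ac)
  qed
  then show ?thesis using orients_finite[OF S] by blast
qed

text \<open>
Counting the sign is avoided as follows. The product over all ordered pairs equals \<open>\<plusminus>D\<^sup>2\<close>, for
\<open>D\<close> the product over the orientation, and it is visibly invariant under a transposition \<open>\<tau>\<close> within a column.
So \<open>\<tau>\<close> maps \<open>D\<close> to \<open>D\<close> or \<open>-D\<close>. If it fixed \<open>D\<close>, the cofactor of \<open>X\<^sub>x - X\<^sub>y\<close> in \<open>D\<close> would be
antisymmetric and hence vanish for \<open>X\<^sub>x = X\<^sub>y\<close>, although none of its factors does.
\<close>

lemma vdm_antisym_polys:
  assumes S: "orients n c S"
  shows "(vdm S :: 'k::field_char_0 mpoly) \<in> antisym_polys n c"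
proof (rule antisym_polysI)
  show "(vdm S :: 'k mpoly) \<in> polys n" using S by (rule vdm_polys)
next
  fix x y assume xy: "x \<in> {1..n}" "y \<in> {1..n}" "x \<noteq> y" "c x = c y"
  define \<tau> where "\<tau> = transpose x y"
  let ?D = "vdm S :: 'k mpoly"
  have fin: "finite S" using S by (rule orients_finite)
  have E: "vdm (S \<union> S\<inverse>) = (- 1) ^ card S * ?D\<^sup>2"
  proof -
    have "vdm (S\<inverse>) = (\<Prod>(u, v)\<in>S. Var v - Var u :: 'k mpoly)"
      unfolding vdm_def by (rule prod.reindex_bij_witness[of _ prod.swap prod.swap]) auto
    also have "\<dots> = (\<Prod>e\<in>S. - 1 * (case e of (u, v) \<Rightarrow> Var u - Var v))"
      by (rule prod.cong) auto
    also have "\<dots> = (- 1) ^ card S * ?D" by (simp only: vdm_def prod.distrib prod_constant)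
    finally have "vdm (S\<inverse>) = (- 1) ^ card S * ?D" .
    moreover have "vdm (S \<union> S\<inverse>) = ?D * vdm (S\<inverse>)"
      unfolding vdm_def using fin S by (intro prod.union_disjoint) (auto dest: orientsD(5))
    ultimately show ?thesis by (simp add: power2_eq_square mult_ac)
  qed
  have \<tau>_in: "\<tau> u \<in> {1..n} \<longleftrightarrow> u \<in> {1..n}" and c\<tau>: "c (\<tau> u) = c u" for u
    using xy by (auto simp: \<tau>_def transpose_def)
  have inv\<tau>: "\<tau> (\<tau> u) = u" for u by (simp add: \<tau>_def)
  have sym: "(\<tau> u, \<tau> v) \<in> S \<union> S\<inverse>" if "(u, v) \<in> S \<union> S\<inverse>" for u v
  proof -
    have "u \<in> {1..n}" "v \<in> {1..n}" "u \<noteq> v" "c u = c v"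
      using that orientsD[OF S, of u v] orientsD[OF S, of v u] by (simp_all, metis+)
    then have "(\<tau> u, \<tau> v) \<in> S \<or> (\<tau> v, \<tau> u) \<in> S"
      by (intro orientsD'[OF S]) (metis \<tau>_in c\<tau> inv\<tau>)+
    then show ?thesis by simp
  qed
  have sym': "map_prod \<tau> \<tau> e \<in> S \<union> S\<inverse>" if "e \<in> S \<union> S\<inverse>" for e
    using sym[of "fst e" "snd e"] that by (cases e) (simp only: map_prod_simp fst_conv snd_conv)
  have inv': "map_prod \<tau> \<tau> (map_prod \<tau> \<tau> e) = e" for e
    by (cases e) (simp add: inv\<tau>)
  have "perm_poly \<tau> (vdm (S \<union> S\<inverse>)) = (\<Prod>(u, v)\<in>S \<union> S\<inverse>. Var (\<tau> u) - Var (\<tau> v) :: 'k mpoly)"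
    unfolding vdm_def perm_poly_prod by (rule prod.cong) (auto simp: perm_poly_diff)
  also have "\<dots> = vdm (S \<union> S\<inverse>)"
    unfolding vdm_def
    by (rule prod.reindex_bij_witness[of _ "map_prod \<tau> \<tau>" "map_prod \<tau> \<tau>"])
      (simp_all only: sym' inv', simp add: split_beta)
  finally have "(perm_poly \<tau> ?D)\<^sup>2 = ?D\<^sup>2"
  proof -
    assume "perm_poly \<tau> (vdm (S \<union> S\<inverse>)) = (vdm (S \<union> S\<inverse>) :: 'k mpoly)"
    then have "(- 1) ^ card S * (perm_poly \<tau> ?D)\<^sup>2 = (- 1) ^ card S * ?D\<^sup>2"
      using perm_poly_of_int[of \<tau> "(- 1) ^ card S", where 'a = 'k]
      by (simp only: E perm_poly_mult power2_eq_square of_int_power of_int_minus of_int_1)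
    then show ?thesis by simp
  qed
  then have "perm_poly \<tau> ?D = ?D \<or> perm_poly \<tau> ?D = - ?D" by (simp only: power2_eq_iff)
  moreover have "perm_poly \<tau> ?D \<noteq> ?D"
  proof
    assume eq: "perm_poly \<tau> ?D = ?D"
    have "(x, y) \<in> S \<or> (y, x) \<in> S" using orientsD'[OF S] xy by blast
    then obtain a b where ab: "(a, b) \<in> S" "{a, b} = {x, y}" by auto
    define R :: "'k mpoly" where "R = vdm (S - {(a, b)})"
    have DR: "?D = (Var a - Var b) * R"
      unfolding R_def vdm_def using fin ab(1) by (subst prod.remove[of S "(a, b)"]) auto
    have "perm_poly \<tau> (Var a - Var b :: 'k mpoly) = - (Var a - Var b)"
      using ab(2) by (auto simp: \<tau>_def perm_poly_diff doubleton_eq_iff)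
    then have "(Var a - Var b) * (- perm_poly \<tau> R) = (Var a - Var b) * R"
      using eq unfolding DR perm_poly_mult by (simp only: mult_minus_left mult_minus_right)
    moreover have "(Var a - Var b :: 'k mpoly) \<noteq> 0"
      using orientsD(3)[OF S ab(1)] by (simp add: Var_eq_iff)
    ultimately have "- perm_poly \<tau> R = R" by (simp only: mult_cancel_left) auto
    then have "perm_poly (transpose x y) R = - R" by (simp add: \<tau>_def minus_equation_iff)
    then have "collapse x y R = 0" by (rule collapse_eq_0)
    moreover have "collapse x y R \<noteq> 0"
      unfolding R_def
    proof (rule collapse_vdm_neq_0)
      show "finite (S - {(a, b)})" using fin by simp
      show "a' \<noteq> b' \<and> {a', b'} \<noteq> {x, y}" if "(a', b') \<in> S - {(a, b)}" for a' b'
        using that ab orientsD[OF S ab(1)] orientsD[OF S, of a' b'] by (auto simp: doubleton_eq_iff)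
    qed
    ultimately show False by simp
  qed
  ultimately show "perm_poly (transpose x y) ?D = - ?D" by (simp add: \<tau>_def)
qed

section \<open>Antisymmetric polynomials of minimal degree\<close>

definition column :: "nat \<Rightarrow> (nat \<Rightarrow> nat) \<Rightarrow> nat \<Rightarrow> nat set" where
  "column n c j = {x \<in> {1..n}. c x = j}"

lemma finite_column [simp]: "finite (column n c j)"
  by (simp add: column_def)

lemma column_move:
  assumes "x0 \<in> column n c i" "i \<noteq> j"
  shows "column n (c(x0 := j)) i = column n c i - {x0}"
    "column n (c(x0 := j)) j = insert x0 (column n c j)"
    "\<And>l. l \<noteq> i \<Longrightarrow> l \<noteq> j \<Longrightarrow> column n (c(x0 := j)) l = column n c l"
  using assms by (auto simp: column_def)

text \<open>
The monomials of least degree that can occur in an antisymmetric polynomial: on every column the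
exponents are \<open>0, 1, 2, \<dots>\<close>, each of them once.
\<close>

definition staircase :: "nat \<Rightarrow> (nat \<Rightarrow> nat) \<Rightarrow> mon \<Rightarrow> bool" where
  "staircase n c e \<longleftrightarrow>
     keys e \<subseteq> {1..n} \<and> (\<forall>j. lookup e ` column n c j = {..<card (column n c j)})"

lemma staircase_inj_on: "staircase n c e \<Longrightarrow> inj_on (lookup e) (column n c j)"
  by (rule eq_card_imp_inj_on) (simp_all add: staircase_def)

lemma staircase_inj:
  assumes "staircase n c e" "x \<in> {1..n}" "y \<in> {1..n}" "c x = c y" "lookup e x = lookup e y"
  shows "x = y"
  using staircase_inj_on[OF assms(1), of "c x"] assms by (auto simp: column_def inj_on_def)

lemma sum_nat_set_ge:
  fixes S :: "nat set"
  assumes "finite S"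
  shows "\<Sum>{..<card S} \<le> \<Sum>S" "\<Sum>S \<le> \<Sum>{..<card S} \<Longrightarrow> S = {..<card S}"
proof -
  have "\<Sum>{..<card S} \<le> \<Sum>S \<and> (\<Sum>S \<le> \<Sum>{..<card S} \<longrightarrow> S = {..<card S})"
    using assms
  proof (induction "card S" arbitrary: S)
    case 0
    then show ?case by simp
  next
    case (Suc k)
    define M where "M = Max S"
    have "S \<noteq> {}" using Suc.hyps(2) by auto
    then have M: "M \<in> S" using Suc.prems by (simp add: M_def)
    have le_M: "x \<le> M" if "x \<in> S" for x using that Suc.prems by (simp add: M_def)
    have card: "card (S - {M}) = k" using Suc.hyps(2) M by simp
    have "card S \<le> card {..M}" by (rule card_mono) (use le_M in auto)
    then have kM: "k \<le> M" using Suc.hyps(2) by simp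
    have IH: "\<Sum>{..<k} \<le> \<Sum>(S - {M})"
      using Suc.hyps(1)[of "S - {M}"] card Suc.prems by simp
    have S: "\<Sum>S = M + \<Sum>(S - {M})" using Suc.prems M by (simp add: sum.remove)
    have C: "\<Sum>{..<card S} = k + \<Sum>{..<k}" by (simp flip: Suc.hyps(2))
    have "S = {..<card S}" if "\<Sum>S \<le> \<Sum>{..<card S}"
    proof -
      have "M = k" using that S C IH kM by linarith
      then have "S \<subseteq> {..<card S}" using le_M by (auto simp: less_Suc_eq_le simp flip: Suc.hyps(2))
      then show ?thesis by (rule card_subset_eq[rotated]) simp_all
    qed
    then show ?case using S C IH kM by linarith
  qed
  then show "\<Sum>{..<card S} \<le> \<Sum>S" "\<Sum>S \<le> \<Sum>{..<card S} \<Longrightarrow> S = {..<card S}" by blast+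
qed

lemma mon_degree_columns:
  assumes "keys m \<subseteq> {1..n}"
  shows "mon_degree m = (\<Sum>j\<in>c ` {1..n}. \<Sum>x\<in>column n c j. lookup m x)"
  unfolding column_def
  by (subst mon_degree_superset[OF _ assms], simp) (rule sum.image_gen, simp)

text \<open>
Different exponents on a column of size \<open>k\<close> add up to at least \<open>0 + \<dots> + (k - 1)\<close>, with equality
only for the exponents \<open>0, \<dots>, k - 1\<close>.
\<close>

lemma staircase_minimal:
  assumes e: "staircase n c e" and m: "keys m \<subseteq> {1..n}"
    and inj: "\<And>j. inj_on (lookup m) (column n c j)" and le: "mon_degree m \<le> mon_degree e"
  shows "staircase n c m"
proof -
  define A where "A j = lookup m ` column n c j" for j
  have card_A: "card (A j) = card (column n c j)" for j
    unfolding A_def by (rule card_image) (rule inj)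
  have fin: "finite (A j)" for j by (simp add: A_def)
  have sum_m: "(\<Sum>x\<in>column n c j. lookup m x) = \<Sum>(A j)" for j
    unfolding A_def by (simp add: sum.reindex[OF inj])
  have sum_e: "(\<Sum>x\<in>column n c j. lookup e x) = \<Sum>{..<card (A j)}" for j
    using sum.reindex[OF staircase_inj_on[OF e, of j], of id] e by (simp add: staircase_def card_A)
  have ge: "\<Sum>{..<card (A j)} \<le> \<Sum>(A j)" for j using fin by (rule sum_nat_set_ge)
  have "\<not> (\<Sum>j\<in>c ` {1..n}. \<Sum>{..<card (A j)}) < (\<Sum>j\<in>c ` {1..n}. \<Sum>(A j))"
    using le e unfolding staircase_def
    by (simp add: mon_degree_columns[OF m, of c] mon_degree_columns[of e n c] sum_m sum_e)
  then have "\<Sum>(A j) \<le> \<Sum>{..<card (A j)}" if "j \<in> c ` {1..n}" for j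
    using ge that by (meson finite_atLeastAtMost finite_imageI not_le sum_strict_mono_ex1)
  then have "A j = {..<card (A j)}" if "j \<in> c ` {1..n}" for j
    using sum_nat_set_ge(2)[OF fin] that by blast
  moreover have "column n c j = {}" if "j \<notin> c ` {1..n}" for j
    using that by (auto simp: column_def)
  ultimately show ?thesis
    unfolding staircase_def using m card_A by (metis A_def card.empty image_empty lessThan_0)
qed

lemma staircase_conjugate:
  assumes e: "staircase n c e" and m: "staircase n c m"
  shows "\<exists>\<sigma>\<in>col_group n c. m = mon_map \<sigma> e"
proof -
  \<comment> \<open>\<open>\<sigma>\<close> sends each \<open>x\<close> to the element of its column whose exponent in \<open>m\<close> is that of \<open>x\<close> in \<open>e\<close>.\<close>
  define \<sigma> where "\<sigma> x = (if x \<in> {1..n} then inv_into (column n c (c x)) (lookup m) (lookup e x) else x)" for x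
  have \<sigma>: "\<sigma> x \<in> {1..n}" "c (\<sigma> x) = c x" "lookup m (\<sigma> x) = lookup e x" if x: "x \<in> {1..n}" for x
  proof -
    have "lookup e x \<in> lookup e ` column n c (c x)" using x by (auto simp: column_def)
    then have "lookup e x \<in> lookup m ` column n c (c x)" using e m by (simp add: staircase_def)
    then have "\<sigma> x \<in> column n c (c x)" "lookup m (\<sigma> x) = lookup e x"
      using x by (simp_all add: \<sigma>_def inv_into_into f_inv_into_f del: atLeastAtMost_iff)
    then show "\<sigma> x \<in> {1..n}" "c (\<sigma> x) = c x" "lookup m (\<sigma> x) = lookup e x"
      by (simp_all add: column_def)
  qed
  have "inj_on \<sigma> {1..n}"
    by (rule inj_onI) (metis \<sigma> staircase_inj[OF e])
  then have perm: "\<sigma> permutes {1..n}"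
    by (rule inj_imp_permutes) (use \<sigma> in \<open>auto simp: \<sigma>_def simp del: atLeastAtMost_iff\<close>)
  have "c (\<sigma> x) = c x" for x
    using \<sigma>(2)[of x] by (cases "x \<in> {1..n}") (simp_all add: \<sigma>_def del: atLeastAtMost_iff)
  then have cg: "\<sigma> \<in> col_group n c" using perm by (simp add: col_group_def)
  have "lookup m (\<sigma> x) = lookup e x" for x
  proof (cases "x \<in> {1..n}")
    case False
    then have "\<sigma> x = x" "x \<notin> keys e" "x \<notin> keys m"
      using e m by (auto simp: \<sigma>_def staircase_def simp del: atLeastAtMost_iff)
    then show ?thesis by (simp add: in_keys_iff)
  qed (rule \<sigma>)
  then have "m = mon_map \<sigma> e"
    using permutes_inverses(1)[OF perm]
    by (intro poly_mapping_eqI) (metis lookup_mon_map permutes_bij[OF perm])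
  then show ?thesis using cg by blast
qed

lemma staircase_exists:
  assumes "\<And>j. column n c j \<noteq> {} \<Longrightarrow> r j \<in> column n c j"
  obtains e where "staircase n c e"
    "\<And>j. column n c j \<noteq> {} \<Longrightarrow> lookup e (r j) = card (column n c j) - 1"
proof -
  have "\<exists>h. h ` column n c j = {..<card (column n c j)} \<and>
      (column n c j \<noteq> {} \<longrightarrow> h (r j) = card (column n c j) - 1)" for j
  proof (cases "column n c j = {}")
    case False
    define A where "A = column n c j"
    have r: "r j \<in> A" using assms[OF False] by (simp add: A_def)
    have cA: "card A = Suc (card (A - {r j}))"
      using r by (metis A_def card.remove finite_column)
    obtain h where h: "bij_betw h (A - {r j}) {0..<card (A - {r j})}"
      using ex_bij_betw_finite_nat[of "A - {r j}"] by (auto simp: A_def)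
    have "(h(r j := card A - 1)) ` A = insert (card A - 1) (h ` (A - {r j}))" using r by auto
    also have "\<dots> = {..<card A}"
      using h cA by (auto simp: bij_betw_def atLeast0LessThan)
    finally show ?thesis by (intro exI[of _ "h(r j := card A - 1)"]) (simp add: A_def)
  qed simp
  then obtain H where H: "\<And>j. H j ` column n c j = {..<card (column n c j)}"
    "\<And>j. column n c j \<noteq> {} \<Longrightarrow> H j (r j) = card (column n c j) - 1"
    by metis
  define e where "e = (\<Sum>x\<in>{1..n}. single x (H (c x) x))"
  have e: "lookup e x = (if x \<in> {1..n} then H (c x) x else 0)" for x
    by (simp add: e_def lookup_sum lookup_single when_def)
  have "lookup e ` column n c j = H j ` column n c j" for j
    by (rule image_cong) (auto simp: e column_def)
  moreover have "keys e \<subseteq> {1..n}" by (auto simp: in_keys_iff e split: if_splits)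
  ultimately have "staircase n c e" using H(1) by (simp add: staircase_def)
  moreover have "lookup e (r j) = card (column n c j) - 1" if "column n c j \<noteq> {}" for j
    using assms[OF that] H(2)[OF that] by (simp add: e column_def)
  ultimately show ?thesis using that by blast
qed

lemma lookup_of_int_mult: "lookup (of_int k * p) m = of_int k * lookup (p :: 'k::comm_ring_1 mpoly) m"
  by (simp flip: scale_eq_of_int)

lemma antisym_polys_subset: "w \<in> antisym_polys n c \<Longrightarrow> w \<in> polys n"
  by (simp add: antisym_polys_def)

lemma antisym_polys_Const_mult: "w \<in> antisym_polys n c \<Longrightarrow> Const a * w \<in> antisym_polys n c"
  by (auto simp: antisym_polys_def polys_mult perm_poly_mult mult.left_commute)
    (simp_all add: Const_def)

lemma antisym_polys_diff: "v \<in> antisym_polys n c \<Longrightarrow> w \<in> antisym_polys n c \<Longrightarrow> v - w \<in> antisym_polys n c"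
  by (auto simp: antisym_polys_def polys_diff perm_poly_diff right_diff_distrib)

lemma lookup_antisym_mon_map:
  assumes "w \<in> antisym_polys n c" "\<sigma> \<in> col_group n c"
  shows "of_int (sign \<sigma>) * lookup w (mon_map \<sigma> m) = lookup w m"
  using assms lookup_perm_poly[OF col_group_bij[OF assms(2)], of w m]
  by (auto simp: antisym_polys_def lookup_of_int_mult)

text \<open>
A transposition of two variables with the same exponent fixes the monomial but negates its coefficient.
\<close>

lemma antisym_keys_inj_on:
  fixes w :: "'k::field_char_0 mpoly"
  assumes w: "w \<in> antisym_polys n c" and m: "m \<in> keys w"
  shows "inj_on (lookup m) (column n c j)"
proof (rule inj_onI, rule ccontr)
  fix x y assume xy: "x \<in> column n c j" "y \<in> column n c j" "lookup m x = lookup m y" "x \<noteq> y"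
  have cg: "transpose x y \<in> col_group n c" using xy by (intro transpose_in_col_group) (auto simp: column_def)
  have "mon_map (transpose x y) m = m"
    by (rule poly_mapping_eqI) (auto simp: lookup_mon_map xy(3) transpose_def)
  then have "- lookup w m = lookup w m"
    using lookup_antisym_mon_map[OF w cg, of m] xy(4) by (simp add: sign_swap_id)
  then show False using m by (simp add: in_keys_iff)
qed

lemma antisym_staircase:
  fixes w :: "'k::field_char_0 mpoly"
  assumes w: "w \<in> antisym_polys n c" and m: "m \<in> keys w"
    and e: "staircase n c e" and le: "mon_degree m \<le> mon_degree e"
  shows "staircase n c m"
  using staircase_minimal[OF e _ antisym_keys_inj_on[OF w m] le]
    polysD[OF antisym_polys_subset[OF w] m] by blast

text \<open>
In the least possible degree an antisymmetric polynomial is determined by a single coefficient: its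
monomials are staircases, and these form one orbit under the column group.
\<close>

lemma antisym_eq_0:
  fixes w :: "'k::field_char_0 mpoly"
  assumes w: "w \<in> antisym_polys n c" and e: "staircase n c e"
    and deg: "deg_le (mon_degree e) w" and 0: "lookup w e = 0"
  shows "w = 0"
proof (rule ccontr)
  assume "w \<noteq> 0"
  then obtain m where m: "m \<in> keys w" using keys_eq_empty by blast
  then have "staircase n c m" using antisym_staircase[OF w m e] deg by (simp add: deg_le_def)
  then obtain \<sigma> where \<sigma>: "\<sigma> \<in> col_group n c" "m = mon_map \<sigma> e" using staircase_conjugate[OF e] by blast
  then have "lookup w m = 0"
    using lookup_antisym_mon_map[OF w \<sigma>(1), of e] 0 by (auto simp: sign_def split: if_splits)
  then show False using m by (simp add: in_keys_iff)
qed

text \<open>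
Orienting the columns by the exponents of a staircase \<open>e\<close> makes the number of factors easy to count:
each \<open>v\<close> is the source of exactly \<open>e v\<close> edges.
\<close>

definition exponent_orientation :: "nat \<Rightarrow> (nat \<Rightarrow> nat) \<Rightarrow> mon \<Rightarrow> (nat \<times> nat) set" where
  "exponent_orientation n c e = (SIGMA v:{1..n}. {u \<in> {1..n}. c u = c v \<and> lookup e u < lookup e v})"

lemma exponent_orientation_orients:
  assumes "staircase n c e"
  shows "orients n c (exponent_orientation n c e)"
  unfolding orients_def exponent_orientation_def
  using staircase_inj[OF assms] by (fastforce simp: linorder_neq_iff)

lemma card_exponent_orientation:
  assumes e: "staircase n c e"
  shows "card (exponent_orientation n c e) = mon_degree e"
proof -
  have "card {u \<in> {1..n}. c u = c v \<and> lookup e u < lookup e v} = lookup e v" if v: "v \<in> {1..n}" for v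
  proof -
    define B where "B = {u \<in> {1..n}. c u = c v \<and> lookup e u < lookup e v}"
    have B: "B = {u \<in> column n c (c v). lookup e u < lookup e v}" by (auto simp: B_def column_def)
    have im: "lookup e ` column n c (c v) = {..<card (column n c (c v))}"
      using e by (simp add: staircase_def)
    moreover have "lookup e v \<in> lookup e ` column n c (c v)" using v by (simp add: column_def)
    ultimately have "{..<lookup e v} \<subseteq> lookup e ` column n c (c v)" by auto
    then have "lookup e ` B = {..<lookup e v}" unfolding B by (force simp: image_iff)
    moreover have "inj_on (lookup e) B"
      by (rule inj_on_subset[OF staircase_inj_on[OF e, of "c v"]]) (simp add: B)
    ultimately show ?thesis by (metis B_def card_image card_lessThan)
  qed
  then have "card (exponent_orientation n c e) = (\<Sum>v\<in>{1..n}. lookup e v)"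
    unfolding exponent_orientation_def by (subst card_SigmaI) auto
  also have "\<dots> = mon_degree e"
    using e by (subst mon_degree_superset[of "{1..n}"]) (auto simp: staircase_def)
  finally show ?thesis .
qed

lemma lookup_vdm_neq_0:
  assumes e: "staircase n c e"
  shows "lookup (vdm (exponent_orientation n c e) :: 'k::field_char_0 mpoly) e \<noteq> 0"
proof
  let ?S = "exponent_orientation n c e"
  have S: "orients n c ?S" using e by (rule exponent_orientation_orients)
  assume "lookup (vdm ?S :: 'k mpoly) e = 0"
  then have "(vdm ?S :: 'k mpoly) = 0"
    using antisym_eq_0[OF vdm_antisym_polys[OF S] e] deg_le_vdm[OF orients_finite[OF S]]
    by (simp add: card_exponent_orientation[OF e])
  moreover have "(vdm ?S :: 'k mpoly) \<noteq> 0"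
    using orients_finite[OF S] orientsD(3)[OF S] by (rule vdm_neq_0)
  ultimately show False by simp
qed

section \<open>Antisymmetrization\<close>

definition antisymmetrize :: "nat \<Rightarrow> (nat \<Rightarrow> nat) \<Rightarrow> 'k::comm_ring_1 mpoly \<Rightarrow> 'k mpoly" where
  "antisymmetrize n c p = (\<Sum>\<sigma>\<in>col_group n c. of_int (sign \<sigma>) * perm_poly \<sigma> p)"

lemma antisymmetrize_in_antisym_polys:
  assumes "p \<in> polys n"
  shows "antisymmetrize n c p \<in> antisym_polys n c"
proof -
  have "perm_poly \<tau> (antisymmetrize n c p) = of_int (sign \<tau>) * antisymmetrize n c p"
    if \<tau>: "\<tau> \<in> col_group n c" for \<tau>
  proof -
    have sgn: "sign (\<tau> \<circ> \<sigma>) = sign \<tau> * sign \<sigma>" if "\<sigma> \<in> col_group n c" for \<sigma>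
      using \<tau> that by (simp add: sign_compose col_group_permutation)
    have "perm_poly \<tau> (antisymmetrize n c p) =
        (\<Sum>\<sigma>\<in>col_group n c. of_int (sign \<sigma>) * perm_poly (\<tau> \<circ> \<sigma>) p)"
      by (simp add: antisymmetrize_def perm_poly_sum perm_poly_mult perm_poly_comp)
    also have "\<dots> = (\<Sum>\<sigma>\<in>col_group n c. of_int (sign \<tau>) * (of_int (sign (\<tau> \<circ> \<sigma>)) * perm_poly (\<tau> \<circ> \<sigma>) p))"
    proof (rule sum.cong[OF refl])
      fix \<sigma> assume "\<sigma> \<in> col_group n c"
      then have "sign \<sigma> = sign \<tau> * sign (\<tau> \<circ> \<sigma>)" by (simp only: sgn) (simp add: sign_def)
      then show "of_int (sign \<sigma>) * perm_poly (\<tau> \<circ> \<sigma>) p =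
          of_int (sign \<tau>) * (of_int (sign (\<tau> \<circ> \<sigma>)) * perm_poly (\<tau> \<circ> \<sigma>) p)"
        by (metis mult.assoc of_int_mult)
    qed
    also have "\<dots> = (\<Sum>\<sigma>\<in>col_group n c. of_int (sign \<tau>) * (of_int (sign \<sigma>) * perm_poly \<sigma> p))"
      by (rule sum.reindex_bij_witness[of _ "\<lambda>\<sigma>. inv' \<tau> \<circ> \<sigma>" "\<lambda>\<sigma>. \<tau> \<circ> \<sigma>"])
        (use \<tau> permutes_inv_o[OF col_group_permutes[OF \<tau>]]
          in \<open>simp_all add: col_group_comp col_group_inv o_assoc\<close>)
    also have "\<dots> = of_int (sign \<tau>) * antisymmetrize n c p"
      by (simp add: antisymmetrize_def sum_distrib_left)
    finally show ?thesis .
  qed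
  moreover have "antisymmetrize n c p \<in> polys n"
    unfolding antisymmetrize_def
    by (intro polys_sum polys_mult polys_of_int polys_perm_poly)
      (use assms permutes_image[OF col_group_permutes] in \<open>auto simp only: order.refl\<close>)
  ultimately show ?thesis by (simp add: antisym_polys_def)
qed

text \<open>
The coefficient of \<open>m\<close> in \<open>\<sigma> p\<close> is that of \<open>\<sigma>\<inverse> m\<close> in \<open>p\<close>; the sum over the
group is then reindexed by inversion.
\<close>

lemma lookup_antisymmetrize:
  "lookup (antisymmetrize n c p) m = (\<Sum>\<sigma>\<in>col_group n c. of_int (sign \<sigma>) * lookup p (mon_map \<sigma> m))"
proof -
  have "lookup (antisymmetrize n c p) m = (\<Sum>\<sigma>\<in>col_group n c. of_int (sign \<sigma>) * lookup (perm_poly \<sigma> p) m)"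
    by (simp add: antisymmetrize_def lookup_sum lookup_of_int_mult)
  also have "\<dots> = (\<Sum>\<sigma>\<in>col_group n c. of_int (sign (inv' \<sigma>)) * lookup p (mon_map (inv' \<sigma>) m))"
  proof (rule sum.cong[OF refl])
    fix \<sigma> assume \<sigma>: "\<sigma> \<in> col_group n c"
    have "lookup (perm_poly \<sigma> p) m = lookup p (mon_map (inv' \<sigma>) m)"
      using lookup_perm_poly[OF col_group_bij[OF \<sigma>], of p "mon_map (inv' \<sigma>) m"]
      by (simp only: mon_map_inv(2)[OF col_group_bij[OF \<sigma>]])
    then show "of_int (sign \<sigma>) * lookup (perm_poly \<sigma> p) m =
        of_int (sign (inv' \<sigma>)) * lookup p (mon_map (inv' \<sigma>) m)"
      by (simp add: sign_inverse col_group_permutation[OF \<sigma>])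
  qed
  also have "\<dots> = (\<Sum>\<sigma>\<in>col_group n c. of_int (sign \<sigma>) * lookup p (mon_map \<sigma> m))"
    by (rule sum.reindex_bij_witness[of _ inv' inv'])
      (auto simp: col_group_inv inv_inv_eq col_group_bij)
  finally show ?thesis .
qed

section \<open>Symmetric ideals that contain all antisymmetric polynomials\<close>

locale symmetric_ideal =
  fixes n :: nat and I :: "'k::field_char_0 mpoly set"
  assumes subset_polys: "p \<in> I \<Longrightarrow> p \<in> polys n"
    and zero: "0 \<in> I"
    and add: "p \<in> I \<Longrightarrow> q \<in> I \<Longrightarrow> p + q \<in> I"
    and mult: "p \<in> polys n \<Longrightarrow> q \<in> I \<Longrightarrow> p * q \<in> I"
    and perm: "\<sigma> permutes {1..n} \<Longrightarrow> p \<in> I \<Longrightarrow> perm_poly \<sigma> p \<in> I"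
begin

lemma sum: "(\<And>x. x \<in> S \<Longrightarrow> f x \<in> I) \<Longrightarrow> sum f S \<in> I"
  by (induction S rule: infinite_finite_induct) (simp_all add: zero add)

text \<open>
The criterion behind both steps of the proof. The antisymmetrization \<open>G\<close> of \<open>F\<close> lies in the ideal and has the
least degree possible, so it is a multiple of the Vandermonde product \<open>D\<close> of the columns. Its coefficient at the staircase
\<open>e\<close> is the sum in the last assumption. If this is nonzero, \<open>D\<close> is conversely a multiple of \<open>G\<close>, and every
antisymmetric polynomial is a multiple of \<open>D\<close>.
\<close>

lemma antisym_polys_subsetI:
  assumes e: "staircase n c e" and F: "F \<in> I" and deg: "deg_le (mon_degree e) F"
    and neq: "(\<Sum>\<sigma>\<in>col_group n c. of_int (sign \<sigma>) * lookup F (mon_map \<sigma> e)) \<noteq> 0"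
  shows "antisym_polys n c \<subseteq> I"
proof -
  let ?S = "exponent_orientation n c e"
  define G where "G = antisymmetrize n c F"
  define D :: "'k mpoly" where "D = vdm ?S"
  have S: "orients n c ?S" using e by (rule exponent_orientation_orients)
  have G: "G \<in> antisym_polys n c"
    unfolding G_def using subset_polys[OF F] by (rule antisymmetrize_in_antisym_polys)
  have D: "D \<in> antisym_polys n c" unfolding D_def using S by (rule vdm_antisym_polys)
  have GI: "G \<in> I"
    unfolding G_def antisymmetrize_def
    by (intro sum mult polys_of_int perm F) (rule col_group_permutes)
  have degG: "deg_le (mon_degree e) G"
    unfolding G_def antisymmetrize_def scale_eq_of_int[symmetric] scale_def
    by (intro deg_le_sum deg_le_Const_mult deg_le_perm_poly deg)
  have degD: "deg_le (mon_degree e) D"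
    using deg_le_vdm[OF orients_finite[OF S]] by (simp add: D_def card_exponent_orientation[OF e])
  have G0: "lookup G e \<noteq> 0" using neq by (simp add: G_def lookup_antisymmetrize)
  \<comment> \<open>This combination is antisymmetric of least degree and has coefficient 0 at \<open>e\<close>.\<close>
  have "Const (lookup G e) * D - Const (lookup D e) * G = 0"
  proof (rule antisym_eq_0[OF _ e])
    show "Const (lookup G e) * D - Const (lookup D e) * G \<in> antisym_polys n c"
      by (intro antisym_polys_diff antisym_polys_Const_mult D G)
    show "deg_le (mon_degree e) (Const (lookup G e) * D - Const (lookup D e) * G)"
      by (intro deg_le_diff deg_le_Const_mult degD degG)
  qed (simp only: lookup_minus lookup_Const_mult, simp)
  then have eq: "Const (lookup G e) * D = Const (lookup D e) * G" by simp
  have "D = Const (lookup D e / lookup G e) * G"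
  proof (rule poly_mapping_eqI)
    fix m
    have "lookup G e * lookup D m = lookup D e * lookup G m"
      using arg_cong[OF eq, of "\<lambda>p. lookup p m"] by simp
    then show "lookup D m = lookup (Const (lookup D e / lookup G e) * G) m"
      using G0 unfolding lookup_Const_mult by (simp add: field_simps)
  qed
  then have "D \<in> I" using mult[OF polys_Const GI] by metis
  show ?thesis
  proof
    fix w :: "'k mpoly" assume "w \<in> antisym_polys n c"
    then obtain q where "q \<in> polys n" "w = D * q"
      using antisym_polys_vdm_dvd S unfolding D_def by blast
    then show "w \<in> I" using mult[OF \<open>q \<in> polys n\<close> \<open>D \<in> I\<close>] by (simp only: mult.commute)
  qed
qed

text \<open>
Moving a box \<open>x0\<close> from column \<open>i\<close> to the smaller column \<open>j\<close> gives a filling \<open>c'\<close>. If the Vandermonde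
product \<open>D\<close> of \<open>c'\<close> lies in the ideal, then so does that of \<open>c\<close>: after multiplication by the power of the variable
\<open>x0\<close> that makes up for the missing degree, the antisymmetrization over the columns of \<open>c\<close> is nonzero, since the
contributions to its coefficient come from the permutations that fix \<open>x0\<close>, and they are all equal. (Up to a
constant this is Lagrange's identity, which writes a Vandermonde determinant as an alternating sum of those with one
variable removed, multiplied by values of a monic polynomial.)
\<close>

lemma antisym_polys_subset_move:
  assumes x0: "x0 \<in> column n c i" and ij: "i \<noteq> j"
    and card: "card (column n c j) < card (column n c i)"
    and sub: "antisym_polys n (c(x0 := j)) \<subseteq> I"
  shows "antisym_polys n c \<subseteq> I"
proof -
  define r where "r l = (if l = i then x0 else SOME x. x \<in> column n c l)" for l
  have "r l \<in> column n c l" if "column n c l \<noteq> {}" for l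
    using x0 that by (auto simp: r_def some_in_eq)
  then obtain e where e: "staircase n c e"
    and top: "\<And>l. column n c l \<noteq> {} \<Longrightarrow> lookup e (r l) = card (column n c l) - 1"
    using staircase_exists[of n c r] by blast
  define a b k where "a = card (column n c i) - 1" and "b = card (column n c j)" and "k = a - b"
  have card_i: "card (column n c i) = Suc a" and ba: "b \<le> a" using card by (simp_all add: a_def b_def)
  have ex0: "lookup e x0 = a" using top[of i] x0 by (auto simp: r_def a_def)
  have x0n: "x0 \<in> {1..n}" and cx0: "c x0 = i" using x0 by (auto simp: column_def)
  define c' where "c' = c(x0 := j)"
  \<comment> \<open>On the enlarged column \<open>j\<close> the largest exponent is \<open>b\<close>, so lowering the exponent of \<open>x0\<close>
    from \<open>a\<close> to \<open>b\<close> turns the staircase for \<open>c\<close> into one for \<open>c'\<close>.\<close>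
  define e' where "e' = e - single x0 k"
  have e'_x0: "lookup e' x0 = b" using ba by (simp add: e'_def lookup_minus ex0 k_def)
  have e'_other: "lookup e' y = lookup e y" if "y \<noteq> x0" for y
    using that by (simp add: e'_def lookup_minus lookup_single)
  have e_eq: "e = single x0 k + e'"
    using ba by (intro poly_mapping_eqI) (auto simp: e'_def lookup_add lookup_minus lookup_single when_def ex0 k_def)
  note col_i = column_move(1)[OF x0 ij, folded c'_def] and col_j = column_move(2)[OF x0 ij, folded c'_def]
    and col_l = column_move(3)[OF x0 ij, folded c'_def]
  have x0j: "x0 \<notin> column n c j" using cx0 ij by (simp add: column_def)
  have card_i': "card (column n c' i) = a" using x0 card_i by (simp add: col_i)
  have e': "staircase n c' e'"
    unfolding staircase_def
  proof (intro conjI allI)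
    show "keys e' \<subseteq> {1..n}"
      using e x0n unfolding staircase_def by (auto simp: in_keys_iff e'_def lookup_minus)
    fix l
    have im: "lookup e ` column n c l = {..<card (column n c l)}" for l
      using e by (simp add: staircase_def)
    consider "l = i" | "l = j" | "l \<noteq> i" "l \<noteq> j" by blast
    then show "lookup e' ` column n c' l = {..<card (column n c' l)}"
    proof cases
      case 1
      have "lookup e' ` (column n c i - {x0}) = lookup e ` (column n c i - {x0})"
        by (rule image_cong) (auto simp: e'_other)
      also have "\<dots> = lookup e ` column n c i - {a}"
        using inj_on_image_set_diff[OF staircase_inj_on[OF e, of i], of "column n c i" "{x0}"] x0
        by (simp add: ex0)
      also have "\<dots> = {..<a}" using im[of i] card_i by auto
      finally show ?thesis using 1 card_i' by (simp add: col_i)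
    next
      case 2
      have "lookup e' ` column n c j = lookup e ` column n c j"
        by (rule image_cong) (use x0j e'_other in metis)+
      then show ?thesis using 2 im[of j] x0j by (simp add: col_j e'_x0 b_def lessThan_Suc)
    next
      case 3
      have "lookup e' ` column n c l = lookup e ` column n c l"
        by (rule image_cong[OF refl], rule e'_other) (use cx0 3 in \<open>auto simp: column_def\<close>)
      then show ?thesis using 3 im[of l] by (simp add: col_l)
    qed
  qed
  define D :: "'k mpoly" where "D = vdm (exponent_orientation n c' e')"
  define F where "F = single (single x0 k) 1 * D"
  have S: "orients n c' (exponent_orientation n c' e')" using e' by (rule exponent_orientation_orients)
  have D: "D \<in> antisym_polys n c'" unfolding D_def using S by (rule vdm_antisym_polys)
  have FI: "F \<in> I"
    unfolding F_def using sub D x0n by (intro mult polys_single) (auto simp: c'_def)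
  have degD: "deg_le (mon_degree e') D"
    using deg_le_vdm[OF orients_finite[OF S]] by (simp add: D_def card_exponent_orientation[OF e'])
  have deg_e: "mon_degree e = k + mon_degree e'" by (subst e_eq) (simp add: mon_degree_add)
  have degF: "deg_le (mon_degree e) F"
    unfolding F_def deg_e using degD by (intro deg_le_mult deg_le_single) auto
  define \<beta> where "\<beta> = lookup D e'"
  have \<beta>: "\<beta> \<noteq> 0" unfolding \<beta>_def D_def using e' by (rule lookup_vdm_neq_0)
  have "of_int (sign \<sigma>) * lookup F (mon_map \<sigma> e) = (if \<sigma> x0 = x0 then \<beta> else 0)"
    if \<sigma>: "\<sigma> \<in> col_group n c" for \<sigma>
  proof (cases "\<sigma> x0 = x0")
    case True
    have inj: "inj \<sigma>" using col_group_bij[OF \<sigma>] by (rule bij_is_inj)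
    have "c' (\<sigma> x) = c' x" for x
      using True col_group_eq[OF \<sigma>, of x] injD[OF inj, of x x0] by (auto simp: c'_def)
    then have "\<sigma> \<in> col_group n c'" using \<sigma> by (simp add: col_group_def)
    moreover have "lookup F (mon_map \<sigma> e) = lookup D (mon_map \<sigma> e')"
      by (subst e_eq) (simp add: F_def mon_map_add True lookup_single_mult)
    ultimately show ?thesis using True lookup_antisym_mon_map[OF D] by (simp add: \<beta>_def)
  next
    case False
    have "lookup F (mon_map \<sigma> e) = 0"
    proof (rule ccontr)
      assume "lookup F (mon_map \<sigma> e) \<noteq> 0"
      then have "mon_map \<sigma> e \<in> keys F" by (simp add: in_keys_iff)
      then obtain m' where m': "m' \<in> keys D" "mon_map \<sigma> e = single x0 k + m'"
        unfolding F_def using keys_mult[of "single (single x0 k) 1" D] by fastforce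
      have "mon_degree m' = mon_degree e'"
        using arg_cong[OF m'(2), of mon_degree] by (simp add: mon_degree_add deg_e)
      then have m'_st: "staircase n c' m'" using antisym_staircase[OF D m'(1) e'] by simp
      have "\<sigma> x0 \<in> {1..n}" using x0n permutes_in_image[OF col_group_permutes[OF \<sigma>]] by simp
      \<comment> \<open>The exponent \<open>a\<close> would belong to \<open>\<sigma> x0\<close>, which is still in column \<open>i\<close>; but this column has
        only \<open>a\<close> elements left, with exponents below \<open>a\<close>.\<close>
      then have "\<sigma> x0 \<in> column n c' i" using False col_group_eq[OF \<sigma>, of x0] cx0 unfolding col_i by (simp add: column_def)
      then have "lookup m' (\<sigma> x0) < a" using m'_st card_i' by (auto simp: staircase_def)
      moreover have "lookup m' (\<sigma> x0) = lookup (mon_map \<sigma> e) (\<sigma> x0)"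
        using False by (simp add: m'(2) lookup_add lookup_single)
      moreover have "lookup (mon_map \<sigma> e) (\<sigma> x0) = a"
        using col_group_bij[OF \<sigma>] by (simp add: lookup_mon_map bij_is_inj ex0)
      ultimately show False by simp
    qed
    then show ?thesis using False by simp
  qed
  then have "(\<Sum>\<sigma>\<in>col_group n c. of_int (sign \<sigma>) * lookup F (mon_map \<sigma> e)) =
      (\<Sum>\<sigma>\<in>col_group n c. if \<sigma> x0 = x0 then \<beta> else 0)"
    by simp
  also have "\<dots> = of_nat (card {\<sigma> \<in> col_group n c. \<sigma> x0 = x0}) * \<beta>"
    by (simp add: finite_col_group flip: sum.inter_filter)
  also have "\<dots> \<noteq> 0"
    using \<beta> id_in_col_group[of n c] finite_col_group[of n c] by auto
  finally show ?thesis using antisym_polys_subsetI[OF e FI degF] by blast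
qed

text \<open>
Suppose that the top part of \<open>P\<close> only involves variables from a transversal \<open>r\<close> of the columns, and that the monomial
\<open>m\<close> gives the variable \<open>r j\<close> the largest exponent of a staircase on column \<open>j\<close>. Multiplying \<open>P\<close> by the
monomial \<open>y\<close> that completes \<open>m\<close> to a staircase puts distinct exponents on the remaining variables of each column.
Then the identity is the only element of the column group that maps this staircase to a monomial of \<open>y P\<close>, so nothing cancels
the coefficient of \<open>m\<close> in the antisymmetrization.
\<close>

lemma antisym_polys_subset_transversal:
  assumes P: "P \<in> I" "deg_le d P" and m: "m \<in> keys P" "mon_degree m = d"
    and r: "\<And>j. column n c j \<noteq> {} \<Longrightarrow> r j \<in> column n c j"
    and m_r: "\<And>j. column n c j \<noteq> {} \<Longrightarrow> lookup m (r j) = card (column n c j) - 1"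
    and supp: "\<And>m'. m' \<in> keys P \<Longrightarrow> mon_degree m' = d \<Longrightarrow> keys m' \<subseteq> r ` {j. column n c j \<noteq> {}}"
  shows "antisym_polys n c \<subseteq> I"
proof -
  define R where "R = r ` {j. column n c j \<noteq> {}}"
  obtain e where e: "staircase n c e"
    and top: "\<And>j. column n c j \<noteq> {} \<Longrightarrow> lookup e (r j) = card (column n c j) - 1"
    using staircase_exists[of n c r] r by blast
  define y where "y = e - m"
  have off_R: "lookup m' x = 0" if "m' \<in> keys P" "mon_degree m' = d" "x \<notin> R" for m' x
    using supp[OF that(1,2)] that(3) by (auto simp: R_def in_keys_iff)
  have "lookup m x \<le> lookup e x" for x
    proof (cases "x \<in> R")
    case True
    then obtain j where "column n c j \<noteq> {}" "x = r j" by (auto simp: R_def)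
    then show ?thesis using top m_r by simp
  qed (simp add: off_R[OF m])
  then have e_eq: "e = y + m"
    by (intro poly_mapping_eqI) (simp add: y_def lookup_add lookup_minus)
  have keys_e: "keys e \<subseteq> {1..n}" using e by (simp add: staircase_def)
  define F where "F = single y 1 * P"
  have "keys y \<subseteq> {1..n}"
    using keys_e by (auto simp: y_def in_keys_iff lookup_minus)
  then have FI: "F \<in> I" unfolding F_def using P by (intro mult polys_single)
  have deg_e: "mon_degree e = mon_degree y + d" by (subst e_eq) (simp add: mon_degree_add m)
  have degF: "deg_le (mon_degree e) F"
    unfolding F_def deg_e using P by (intro deg_le_mult deg_le_single) auto
  have "of_int (sign \<sigma>) * lookup F (mon_map \<sigma> e) = (if \<sigma> = id then lookup P m else 0)"
    if \<sigma>: "\<sigma> \<in> col_group n c" for \<sigma>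
  proof (cases "\<sigma> = id")
    case True
    have "lookup F e = lookup P m" by (subst e_eq) (simp add: F_def lookup_single_mult)
    then show ?thesis using True by simp
  next
    case False
    have "lookup F (mon_map \<sigma> e) = 0"
    proof (rule ccontr)
      assume "lookup F (mon_map \<sigma> e) \<noteq> 0"
      then have "mon_map \<sigma> e \<in> keys F" by (simp add: in_keys_iff)
      then obtain m' where m': "m' \<in> keys P" "mon_map \<sigma> e = y + m'"
        unfolding F_def using keys_mult[of "single y 1" P] by fastforce
      have deg_m': "mon_degree m' = d"
        using arg_cong[OF m'(2), of mon_degree] by (simp add: mon_degree_add deg_e)
      have perm: "\<sigma> permutes {1..n}" using \<sigma> by (rule col_group_permutes)
      have bij: "bij \<sigma>" using \<sigma> by (rule col_group_bij)
      \<comment> \<open>Away from the transversal the exponents are those of \<open>y\<close>, and they differ within each column.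
        A permutation that preserves the columns and fixes all but one element of each is the identity.\<close>
      have fix1: "\<sigma> x = x" if x: "x \<in> {1..n}" "x \<notin> R" for x
      proof -
        have "lookup e (inv' \<sigma> x) = lookup e x"
          using off_R[OF m x(2)] off_R[OF m'(1) deg_m' x(2)] arg_cong[OF m'(2), of "\<lambda>m. lookup m x"]
            arg_cong[OF e_eq, of "\<lambda>m. lookup m x"]
          by (simp add: lookup_mon_map[OF bij] lookup_add)
        moreover have "inv' \<sigma> x \<in> {1..n}" using x permutes_in_image[OF permutes_inv[OF perm]] by simp
        moreover have "c (inv' \<sigma> x) = c x" using col_group_inv[OF \<sigma>] by (rule col_group_eq)
        ultimately have "inv' \<sigma> x = x" using staircase_inj[OF e] x(1) by blast
        then show ?thesis using permutes_inverses(1)[OF perm, of x] by simp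
      qed
      have "\<sigma> x = x" for x
      proof (cases "x \<in> {1..n}")
        case False
        then show ?thesis using perm by (simp add: permutes_not_in)
      next
        case x: True
        show ?thesis
        proof (cases "x \<in> R")
          case False
          then show ?thesis using fix1 x by blast
        next
          case True
          then obtain j where j: "x = r j" "x \<in> column n c j" using r by (auto simp: R_def)
          have in_R: "z = r (c z)" if zR: "z \<in> R" for z
          proof -
            obtain j where j: "z = r j" "column n c j \<noteq> {}" using zR unfolding R_def by blast
            then have "c z = j" using r[of j] by (simp add: column_def)
            then show ?thesis using j by simp
          qed
          show ?thesis
          proof (rule ccontr)
            assume neq: "\<sigma> x \<noteq> x"
            have "\<sigma> x \<in> {1..n}" using x permutes_in_image[OF perm] by simp
            moreover have "\<sigma> x \<notin> R"
              using in_R[of "\<sigma> x"] in_R[OF True] col_group_eq[OF \<sigma>, of x] neq by auto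
            ultimately have "\<sigma> (\<sigma> x) = \<sigma> x" by (rule fix1)
            then show False using neq permutes_inj[OF perm] by (metis injD)
          qed
        qed
      qed
      then show False using False by (auto simp: fun_eq_iff)
    qed
    then show ?thesis using False by simp
  qed
  then have "(\<Sum>\<sigma>\<in>col_group n c. of_int (sign \<sigma>) * lookup F (mon_map \<sigma> e)) = lookup P m"
    using id_in_col_group[of n c] by (simp add: finite_col_group)
  then show ?thesis
    using antisym_polys_subsetI[OF e FI degF] m by (simp add: in_keys_iff)
qed

end

section \<open>Dominance and conjugate partitions\<close>

lemma permutes_extending_inj_on:
  assumes "finite A" "U \<subseteq> A" "f ` U \<subseteq> A" "inj_on f U"
  obtains \<pi> where "\<pi> permutes A" "\<And>x. x \<in> U \<Longrightarrow> \<pi> x = f x"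
proof -
  have "card (A - U) = card (A - f ` U)"
    using assms by (simp add: card_Diff_subset finite_subset card_image)
  then obtain g where g: "bij_betw g (A - U) (A - f ` U)"
    using assms finite_same_card_bij by (metis finite_Diff)
  define \<pi> where "\<pi> x = (if x \<in> U then f x else if x \<in> A then g x else x)" for x
  have "bij_betw \<pi> (U \<union> (A - U)) (f ` U \<union> (A - f ` U))"
  proof (rule bij_betw_combine)
    show "bij_betw \<pi> U (f ` U)"
      using assms(4) by (auto simp: \<pi>_def bij_betw_def inj_on_def image_def)
    show "bij_betw \<pi> (A - U) (A - f ` U)"
      using g by (subst bij_betw_cong[of _ _ g]) (auto simp: \<pi>_def)
  qed auto
  moreover have "U \<union> (A - U) = A" "f ` U \<union> (A - f ` U) = A" using assms by auto
  ultimately have "\<pi> permutes A"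
    using assms(2) by (intro bij_imp_permutes) (auto simp: \<pi>_def)
  then show ?thesis using that by (auto simp: \<pi>_def)
qed

lemma sum_card_column: "(\<Sum>j<t. card (column n c j)) = card {x \<in> {1..n}. c x < t}"
proof -
  have "card (\<Union>j\<in>{..<t}. column n c j) = (\<Sum>j<t. card (column n c j))"
    by (rule card_UN_disjoint) (auto simp: column_def)
  moreover have "(\<Union>j\<in>{..<t}. column n c j) = {x \<in> {1..n}. c x < t}"
    by (auto simp: column_def)
  ultimately show ?thesis by simp
qed

text \<open>
Double counting of the pairs \<open>(i, j)\<close> with \<open>i < f j\<close>. With the parts of a partition as \<open>f\<close> it gives the sum of
the first \<open>r\<close> parts of the dual partition.
\<close>

lemma sum_card_less_eq_sum_min:
  fixes f :: "'b \<Rightarrow> nat"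
  assumes "finite J"
  shows "(\<Sum>i<r. card {j \<in> J. i < f j}) = (\<Sum>j\<in>J. min (f j) r)"
proof -
  have "(\<Sum>i<r. card {j \<in> J. i < f j}) = (\<Sum>i<r. \<Sum>j\<in>J. if i < f j then 1 else 0)"
    using assms by (simp add: sum.If_cases Int_def)
  also have "\<dots> = (\<Sum>j\<in>J. \<Sum>i<r. if i < f j then 1 else 0)" by (rule sum.swap)
  also have "\<dots> = (\<Sum>j\<in>J. min (f j) r)"
  proof (rule sum.cong[OF refl])
    fix j
    have "{..<r} \<inter> {i. i < f j} = {..<min (f j) r}" by auto
    then show "(\<Sum>i<r. if i < f j then 1 else 0) = min (f j) r" by (simp add: sum.If_cases)
  qed
  finally show ?thesis .
qed

text \<open>
Passing to dual partitions reverses dominance. Let \<open>\<nu>\<close> be the dual of \<open>M\<close> and let \<open>r\<close> be the number of parts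
of \<open>lam\<close> larger than \<open>t\<close>. The boxes of \<open>lam\<close> outside its first \<open>t\<close> columns lie in its first \<open>r\<close> rows, so their
number is the sum of the first \<open>r\<close> rows of \<open>lam\<close> minus \<open>r t\<close>. By dominance this is at most the corresponding
number for \<open>\<nu>\<close>, which is at most the number of boxes of \<open>\<nu>\<close> outside its first \<open>t\<close> columns.
\<close>

lemma conjugate_dominance:
  assumes lam: "sorted_wrt (\<ge>) lam" "sum_list lam = sum_list M"
    and dom: "lam \<unlhd>\<^sub>d dual_partition M"
  shows "(\<Sum>j<t. if j < length M then M ! j else 0) \<le> (\<Sum>j<t. card {i. i < length lam \<and> j < lam ! i})"
proof -
  define L where "L = length lam"
  define \<nu> where "\<nu> i = card {j \<in> {..<length M}. i < M ! j}" for i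
  have sum_lam: "sum_list lam = (\<Sum>i<L. lam ! i)" and sum_M: "sum_list M = (\<Sum>j<length M. M ! j)"
    by (simp_all add: sum_list_sum_nth L_def atLeast0LessThan)
  have dec: "lam ! j \<le> lam ! i" if "i \<le> j" "j < L" for i j
    using lam(1) that by (cases "i = j") (auto simp: sorted_wrt_iff_nth_less L_def)
  have dual_nth: "dual_partition M ! i = \<nu> i" if "i < length (dual_partition M)" for i
    using that by (simp add: dual_partition_def \<nu>_def Suc_le_eq del: upt_Suc)
  have len_dual: "length (dual_partition M) = Max (insert 0 (set M))"
    by (simp add: dual_partition_def)
  have prefix: "(\<Sum>i<r. lam ! i) \<le> (\<Sum>i<r. \<nu> i)" if r: "r \<le> L" for r
  proof (cases "r \<le> length (dual_partition M)")
    case True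
    have "sum_list (take r lam) \<le> sum_list (take r (dual_partition M))"
    proof (cases "r = 0")
      case False
      then show ?thesis using dom r True by (simp add: dominated_by_def L_def)
    qed simp
    moreover have "sum_list (take r lam) = (\<Sum>i<r. lam ! i)"
      using r by (simp add: sum_list_sum_nth L_def atLeast0LessThan)
    moreover have "sum_list (take r (dual_partition M)) = (\<Sum>i<r. dual_partition M ! i)"
      using True by (simp add: sum_list_sum_nth atLeast0LessThan)
    moreover have "\<dots> = (\<Sum>i<r. \<nu> i)" using True by (intro sum.cong) (auto intro: dual_nth)
    ultimately show ?thesis by simp
  next
    case False
    have "M ! j \<le> r" if "j < length M" for j
    proof -
      have "M ! j \<le> Max (insert 0 (set M))" using that by (intro Max_ge) auto
      then show ?thesis using False by (simp add: len_dual)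
    qed
    then have "(\<Sum>i<r. \<nu> i) = sum_list M"
      unfolding \<nu>_def sum_M by (subst sum_card_less_eq_sum_min) (auto intro!: sum.cong)
    moreover have "(\<Sum>i<r. lam ! i) \<le> sum_list lam"
      unfolding sum_lam using r by (intro sum_mono2) auto
    ultimately show ?thesis using lam(2) by simp
  qed
  \<comment> \<open>Since the parts are decreasing, this is the number of parts larger than \<open>t\<close>.\<close>
  define r where "r = (LEAST i. i = L \<or> lam ! i \<le> t)"
  have r: "r = L \<or> lam ! r \<le> t" unfolding r_def by (rule LeastI[of _ L]) simp
  have rL: "r \<le> L" unfolding r_def by (rule Least_le) simp
  have below: "t < lam ! i" if "i < r" for i
    using not_less_Least[of i "\<lambda>i. i = L \<or> lam ! i \<le> t"] that by (auto simp: r_def not_le)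
  have above: "lam ! i \<le> t" if "r \<le> i" "i < L" for i
    using r dec[OF that] that by auto
  have split: "{..<L} = {..<r} \<union> {r..<L}" using rL by auto
  have "(\<Sum>i<L. min (lam ! i) t) = (\<Sum>i<r. min (lam ! i) t) + (\<Sum>i\<in>{r..<L}. min (lam ! i) t)"
    unfolding split by (rule sum.union_disjoint) auto
  moreover have "(\<Sum>i<r. min (lam ! i) t) = r * t"
  proof -
    have "(\<Sum>i<r. min (lam ! i) t) = (\<Sum>i<r. t)"
      using below by (intro sum.cong) (auto simp: min_absorb2 less_imp_le_nat)
    then show ?thesis by simp
  qed
  moreover have "(\<Sum>i\<in>{r..<L}. min (lam ! i) t) = (\<Sum>i\<in>{r..<L}. lam ! i)"
    using above by (intro sum.cong) auto
  moreover have "sum_list lam = (\<Sum>i<r. lam ! i) + (\<Sum>i\<in>{r..<L}. lam ! i)"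
    unfolding sum_lam split by (rule sum.union_disjoint) auto
  ultimately have lam_min: "(\<Sum>i<L. min (lam ! i) t) + (\<Sum>i<r. lam ! i) = sum_list lam + r * t" by simp
  \<comment> \<open>Cut the diagram with column lengths \<open>M\<close> after its first \<open>t\<close> columns.\<close>
  define J1 J2 where "J1 = {..<min t (length M)}" and "J2 = {t..<length M}"
  have J: "{..<length M} = J1 \<union> J2" "J1 \<inter> J2 = {}" by (auto simp: J1_def J2_def)
  have "sum_list M = (\<Sum>j\<in>J1. M ! j) + (\<Sum>j\<in>J2. M ! j)"
    unfolding sum_M J(1) using J(2) by (intro sum.union_disjoint) (auto simp: J1_def J2_def)
  moreover have "(\<Sum>i<r. \<nu> i) = (\<Sum>j\<in>J1. min (M ! j) r) + (\<Sum>j\<in>J2. min (M ! j) r)"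
    unfolding \<nu>_def using J(2)
    by (subst sum_card_less_eq_sum_min, simp) (subst J(1), rule sum.union_disjoint, auto simp: J1_def J2_def)
  moreover have "(\<Sum>j\<in>J1. min (M ! j) r) \<le> r * t"
  proof -
    have "(\<Sum>j\<in>J1. min (M ! j) r) \<le> (\<Sum>j\<in>J1. r)" by (rule sum_mono) simp
    also have "\<dots> \<le> r * t" by (simp add: J1_def)
    finally show ?thesis .
  qed
  moreover have "(\<Sum>j\<in>J2. min (M ! j) r) \<le> (\<Sum>j\<in>J2. M ! j)" by (rule sum_mono) simp
  ultimately have "(\<Sum>j\<in>J1. M ! j) \<le> (\<Sum>i<L. min (lam ! i) t)"
    using lam_min prefix[OF rL] lam(2) by linarith
  moreover have "(\<Sum>j<t. if j < length M then M ! j else 0) = (\<Sum>j\<in>J1. M ! j)"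
    by (rule sum.mono_neutral_cong_right) (auto simp: J1_def)
  moreover have "(\<Sum>j<t. card {i. i < length lam \<and> j < lam ! i}) = (\<Sum>i<L. min (lam ! i) t)"
    using sum_card_less_eq_sum_min[of "{..<L}" "\<lambda>i. lam ! i" t] by (simp add: L_def)
  ultimately show ?thesis by simp
qed

section \<open>The partition of a monomial\<close>

lemma exponent_partition_enum:
  obtains xs where "distinct xs" "set xs = keys m" "map (lookup m) xs = exponent_partition m"
proof
  let ?ys = "sorted_list_of_set (keys m)"
  let ?xs = "rev (sort_key (lookup m) ?ys)"
  show "distinct ?xs" "set ?xs = keys m" by simp_all
  have "sort (map (lookup m) ?ys) = map (lookup m) (sort_key (lookup m) ?ys)"
    by (rule properties_for_sort) simp_all
  then show "map (lookup m) ?xs = exponent_partition m"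
    by (simp add: exponent_partition_def rev_map)
qed

lemma length_exponent_partition: "length (exponent_partition m) = mon_weight m"
  by (simp add: exponent_partition_def mon_weight_def)

lemma sum_list_exponent_partition: "sum_list (exponent_partition m) = mon_degree m"
proof -
  obtain xs where xs: "distinct xs" "set xs = keys m" "map (lookup m) xs = exponent_partition m"
    by (rule exponent_partition_enum)
  have "sum_list (exponent_partition m) = (\<Sum>x\<in>set xs. lookup m x)"
    using sum_list_distinct_conv_sum_set[OF xs(1), of "lookup m"] xs(3) by simp
  then show ?thesis by (simp add: xs(2) mon_degree_def)
qed

lemma mon_partition_facts:
  assumes "mon_degree m + mon_weight m \<le> n"
  shows "length (mon_partition n m) = n - mon_degree m" "sum_list (mon_partition n m) = n"
    "sorted_wrt (\<ge>) (mon_partition n m)"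
    "\<And>j. j < mon_weight m \<Longrightarrow> mon_partition n m ! j = Suc (exponent_partition m ! j)"
    "\<And>j. mon_weight m \<le> j \<Longrightarrow> j < n - mon_degree m \<Longrightarrow> mon_partition n m ! j = 1"
proof -
  show "length (mon_partition n m) = n - mon_degree m"
    using assms by (simp add: mon_partition_def length_exponent_partition)
  have "sum_list (map Suc xs) = sum_list xs + length xs" for xs by (induction xs) auto
  then show "sum_list (mon_partition n m) = n"
    using assms by (simp add: mon_partition_def length_exponent_partition sum_list_exponent_partition sum_list_replicate)
  have "sorted_wrt (\<ge>) (exponent_partition m)"
    by (simp add: exponent_partition_def sorted_wrt_rev)
  moreover have "sorted_wrt (\<ge>) (replicate k (1::nat))" for k by (induction k) auto
  ultimately show "sorted_wrt (\<ge>) (mon_partition n m)"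
    by (auto simp: mon_partition_def sorted_wrt_append sorted_wrt_map)
  show "mon_partition n m ! j = Suc (exponent_partition m ! j)" if "j < mon_weight m" for j
    using that by (simp add: mon_partition_def nth_append length_exponent_partition)
  show "mon_partition n m ! j = 1" if "mon_weight m \<le> j" "j < n - mon_degree m" for j
    using that by (simp add: mon_partition_def nth_append length_exponent_partition)
qed

lemma hom_component_keys: "keys (hom_component d p) = {m \<in> keys p. mon_degree m = d}"
proof -
  have "lookup (hom_component d p) m = (if mon_degree m = d then lookup p m else 0)" for m
    by (simp add: hom_component_def lookup_sum lookup_single when_def)
      (auto simp: sum.If_cases in_keys_iff)
  then show ?thesis by (auto simp: in_keys_iff split: if_splits)
qed

lemma deg_le_poly_degree: "deg_le (poly_degree p) p"
  by (auto simp: deg_le_def poly_degree_def)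

section \<open>From the shape of a monomial to all dominated shapes\<close>

context symmetric_ideal
begin

text \<open>
Any \<open>c\<close> whose column sizes \<open>h\<close> dominate \<open>\<mu>\<close> can be transformed into one with column sizes \<open>\<mu>\<close> by moving
single boxes, from some column \<open>i\<close> with \<open>h i > \<mu> i\<close> to the first column \<open>j\<close> with \<open>h j < \<mu> j\<close>. The sizes
\<open>h\<close> do not stay sorted along the way, which is why dominance is stated for functions here. The induction is on the total
deficit of \<open>h\<close> with respect to \<open>\<mu>\<close>.
\<close>

lemma antisym_polys_subset_dominating:
  fixes \<mu> :: "nat \<Rightarrow> nat"
  assumes base: "\<And>c. (\<And>j. card (column n c j) = \<mu> j) \<Longrightarrow> antisym_polys n c \<subseteq> I"
    and mono: "antimono \<mu>" and N: "(\<Sum>j<N. \<mu> j) = n" "\<And>j. N \<le> j \<Longrightarrow> \<mu> j = 0"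
    and dom: "\<And>t. (\<Sum>j<t. \<mu> j) \<le> (\<Sum>j<t. card (column n c j))"
  shows "antisym_polys n c \<subseteq> I"
  using dom
proof (induction "\<Sum>j<N. \<mu> j - card (column n c j)" arbitrary: c rule: less_induct)
  case less
  define h where "h j = card (column n c j)" for j
  have dom: "(\<Sum>j<t. \<mu> j) \<le> (\<Sum>j<t. h j)" for t using less.prems by (simp add: h_def)
  show ?case
  proof (cases "\<exists>j. h j < \<mu> j")
    case False
    have "h i = \<mu> i" for i
    proof (rule ccontr)
      assume "h i \<noteq> \<mu> i"
      then have i: "\<mu> i < h i" using False by (meson linorder_neqE_nat)
      define M where "M = max N (Suc i)"
      have "n \<le> (\<Sum>j<M. \<mu> j)" unfolding N(1)[symmetric] by (rule sum_mono2) (auto simp: M_def)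
      also have "\<dots> < (\<Sum>j<M. h j)"
        using i False by (intro sum_strict_mono_ex1) (auto simp: M_def not_less intro!: bexI[of _ i])
      also have "\<dots> = card {x \<in> {1..n}. c x < M}" unfolding h_def by (rule sum_card_column)
      also have "\<dots> \<le> card {1..n}" by (rule card_mono) auto
      finally show False by simp
    qed
    then show ?thesis using base by (simp add: h_def)
  next
    case True
    define j where "j = (LEAST j. h j < \<mu> j)"
    have j: "h j < \<mu> j" unfolding j_def using True by (rule LeastI_ex)
    have before: "\<mu> l \<le> h l" if "l < j" for l
      using not_less_Least[of l "\<lambda>j. h j < \<mu> j"] that by (simp add: j_def)
    have "(\<Sum>l<j. \<mu> l) < (\<Sum>l<j. h l)" using dom[of "Suc j"] j by simp
    then obtain i where i: "i < j" "\<mu> i < h i"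
      by (metis lessThan_iff not_less sum_mono)
    have "\<mu> j \<le> \<mu> i" using mono i(1) by (simp add: antimono_def)
    then have hij: "h j < h i" using i j by simp
    obtain x0 where x0: "x0 \<in> column n c i"
      using i(2) by (metis card.empty equals0I h_def not_less_zero)
    define c' where "c' = c(x0 := j)"
    have x0n: "x0 \<in> {1..n}" "c x0 = i" using x0 by (auto simp: column_def)
    have ij: "i \<noteq> j" using i(1) by simp
    note col_i = column_move(1)[OF x0 ij, folded c'_def] and col_j = column_move(2)[OF x0 ij, folded c'_def]
      and col_l = column_move(3)[OF x0 ij, folded c'_def]
    have "x0 \<notin> column n c j" using x0n i(1) by (simp add: column_def)
    then have card_j: "card (column n c' j) = Suc (h j)" by (simp add: col_j h_def)
    have card_i: "card (column n c' i) = h i - 1" using x0 by (simp add: col_i h_def)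
    have card_l: "card (column n c' l) = h l" if "l \<noteq> i" "l \<noteq> j" for l
      using that by (simp add: col_l h_def)
    have "antisym_polys n c' \<subseteq> I"
    proof (rule less.hyps)
      have "j < N" using j N(2)[of j] by (cases "j < N") auto
      moreover have "\<mu> l - card (column n c' l) \<le> \<mu> l - h l" for l
        using card_i card_j card_l[of l] i by (cases "l = i"; cases "l = j") auto
      ultimately show "(\<Sum>j<N. \<mu> j - card (column n c' j)) < (\<Sum>j<N. \<mu> j - card (column n c j))"
        unfolding h_def[symmetric] using j card_j
        by (intro sum_strict_mono_ex1) (auto intro!: bexI[of _ j])
    next
      fix t
      have cnt: "(\<Sum>l<t. h l) = card {x \<in> {1..n}. c x < t}" unfolding h_def by (rule sum_card_column)
      have cnt': "(\<Sum>l<t. card (column n c' l)) = card {x \<in> {1..n}. c' x < t}" by (rule sum_card_column)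
      show "(\<Sum>l<t. \<mu> l) \<le> (\<Sum>l<t. card (column n c' l))"
      proof (cases "i < t \<and> t \<le> j")
        case True
        have "(\<Sum>l<t. \<mu> l) < (\<Sum>l<t. h l)"
          using True i before by (intro sum_strict_mono_ex1) (auto intro!: bexI[of _ i])
        moreover have "{x \<in> {1..n}. c' x < t} = {x \<in> {1..n}. c x < t} - {x0}"
          using True by (auto simp: c'_def)
        moreover have "card ({x \<in> {1..n}. c x < t} - {x0}) = card {x \<in> {1..n}. c x < t} - 1"
          using True x0n by (intro card_Diff_singleton) auto
        ultimately show ?thesis unfolding cnt cnt' by simp
      next
        case False
        then have "{x \<in> {1..n}. c' x < t} = {x \<in> {1..n}. c x < t}"
          using i x0n by (auto simp: c'_def)
        then show ?thesis using dom[of t] unfolding cnt cnt' by simp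
      qed
    qed
    then show ?thesis
      using antisym_polys_subset_move[OF x0 less_imp_neq[OF i(1)]] hij by (simp add: c'_def h_def)
  qed
qed

text \<open>
Since \<open>d + wt P\<^sub>d \<le> n\<close>, the variables of the top part of \<open>P\<close> can be permuted into a transversal of the columns,
with the variable of \<open>m\<close> of \<open>j\<close>-th largest exponent \<open>k\<close> sent to the column \<open>j\<close>, of size \<open>k + 1\<close>,
and the variables outside \<open>m\<close> sent to columns of size one.
\<close>

lemma antisym_polys_subset_mon_partition:
  assumes P: "P \<in> I" "deg_le d P" and wt: "d + wt (hom_component d P) \<le> n"
    and m: "m \<in> keys (hom_component d P)"
    and c: "\<And>j. card (column n c j) =
      (if j < length (mon_partition n m) then mon_partition n m ! j else 0)"
  shows "antisym_polys n c \<subseteq> I"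
proof -
  define U where "U = (\<Union>m'\<in>keys (hom_component d P). keys m')"
  have mP: "m \<in> keys P" "mon_degree m = d" using m by (simp_all add: hom_component_keys)
  have keys_mU: "keys m \<subseteq> U" using m by (auto simp: U_def)
  have Un: "U \<subseteq> {1..n}"
    using polysD[OF subset_polys[OF P(1)]] by (auto simp: U_def hom_component_keys)
  have finU: "finite U" by (simp add: U_def)
  have cardU: "d + card U \<le> n" using wt by (simp add: wt_def U_def)
  define l where "l = mon_weight m"
  have lU: "l \<le> card U" unfolding l_def mon_weight_def by (rule card_mono[OF finU keys_mU])
  have "mon_degree m + mon_weight m \<le> n" using lU cardU by (simp add: mP l_def)
  note M = mon_partition_facts[OF this]
  obtain xs where xs: "distinct xs" "set xs = keys m" "map (lookup m) xs = exponent_partition m"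
    by (rule exponent_partition_enum)
  have len_xs: "length xs = l" using arg_cong[OF xs(3), of length] by (simp add: l_def length_exponent_partition)
  have nonempty: "column n c j \<noteq> {} \<longleftrightarrow> j < n - d" for j
  proof -
    have "column n c j \<noteq> {} \<longleftrightarrow> card (column n c j) \<noteq> 0" by simp
    moreover have "mon_partition n m ! j \<noteq> 0" if "j < n - d"
      using M(4)[of j] M(5)[of j] that mP(2) by (cases "j < mon_weight m") auto
    ultimately show ?thesis using c[of j] M(1) mP(2) by auto
  qed
  define r where "r j = (SOME x. x \<in> column n c j)" for j
  have r: "r j \<in> column n c j" if "column n c j \<noteq> {}" for j
    using that by (simp add: r_def some_in_eq)
  have c_r: "c (r j) = j" if "j < n - d" for j
    using r[of j] nonempty[of j] that by (simp add: column_def)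
  have "card (U - keys m) \<le> card {l..<n - d}"
    using cardU keys_mU finU by (simp add: card_Diff_subset l_def mon_weight_def)
  then obtain g2 where g2: "g2 ` (U - keys m) \<subseteq> {l..<n - d}" "inj_on g2 (U - keys m)"
    using card_le_inj[of "U - keys m" "{l..<n - d}"] finU by auto
  obtain g1 where g1: "\<And>i. i < l \<Longrightarrow> g1 (xs ! i) = i" "bij_betw g1 (keys m) {..<l}"
  proof
    have "bij_betw ((!) xs) {..<l} (keys m)"
      using bij_betw_nth[OF xs(1), of "{..<l}" "keys m"] len_xs xs(2) by simp
    then show "bij_betw (inv_into {..<l} ((!) xs)) (keys m) {..<l}" by (rule bij_betw_inv_into)
    show "inv_into {..<l} ((!) xs) (xs ! i) = i" if "i < l" for i
      using that xs(1) len_xs by (intro inv_into_f_f) (auto simp: inj_on_def nth_eq_iff_index_eq)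
  qed
  \<comment> \<open>The column of each variable of the top part: \<open>g1\<close> follows the order of the exponents of \<open>m\<close>,
    and \<open>g2\<close> uses the columns of size one, which are those from \<open>l\<close> on.\<close>
  define g where "g x = (if x \<in> keys m then g1 x else g2 x)" for x
  have g1_less: "g1 x < l" if "x \<in> keys m" for x
    using g1(2) that by (auto simp: bij_betw_def)
  have g2_ge: "l \<le> g2 x \<and> g2 x < n - d" if "x \<in> U" "x \<notin> keys m" for x
    using g2(1) that by auto
  have lnd: "l \<le> n - d" using lU cardU by simp
  have g_less: "g x < n - d" if "x \<in> U" for x
    using g1_less[of x] g2_ge[OF that] lnd by (auto simp: g_def)
  have g_inj: "inj_on g U"
  proof (rule inj_onI)
    fix x y assume xy: "x \<in> U" "y \<in> U" "g x = g y"
    consider "x \<in> keys m" "y \<in> keys m" | "x \<notin> keys m" "y \<notin> keys m"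
      | "x \<in> keys m" "y \<notin> keys m" | "x \<notin> keys m" "y \<in> keys m" by blast
    then show "x = y"
    proof cases
      case 1
      then show ?thesis using xy(3) g1(2) by (auto simp: g_def bij_betw_def inj_on_def)
    next
      case 2
      then show ?thesis using xy g2(2) by (auto simp: g_def inj_on_def)
    next
      case 3
      then show ?thesis using xy g1_less[of x] g2_ge[of y] by (simp add: g_def)
    next
      case 4
      then show ?thesis using xy g1_less[of y] g2_ge[of x] by (simp add: g_def)
    qed
  qed
  have "inj_on (\<lambda>x. r (g x)) U"
    by (rule inj_onI) (metis c_r g_less g_inj inj_onD)
  moreover have "(\<lambda>x. r (g x)) ` U \<subseteq> {1..n}"
    using r nonempty g_less by (fastforce simp: column_def)
  ultimately obtain \<pi> where \<pi>: "\<pi> permutes {1..n}" "\<And>x. x \<in> U \<Longrightarrow> \<pi> x = r (g x)"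
    using permutes_extending_inj_on[of "{1..n}" U "\<lambda>x. r (g x)"] Un by auto
  have bij: "bij \<pi>" using \<pi>(1) by (rule permutes_bij)
  show ?thesis
  proof (rule antisym_polys_subset_transversal[where P = "perm_poly \<pi> P" and m = "mon_map \<pi> m"])
    show "perm_poly \<pi> P \<in> I" using \<pi>(1) P(1) by (rule perm)
    show "deg_le d (perm_poly \<pi> P)" using P(2) by (rule deg_le_perm_poly)
    show "mon_map \<pi> m \<in> keys (perm_poly \<pi> P)"
      using mP(1) by (simp add: in_keys_iff lookup_perm_poly[OF bij])
    show "mon_degree (mon_map \<pi> m) = d" using mP(2) by simp
    show "r j \<in> column n c j" if "column n c j \<noteq> {}" for j using that by (rule r)
    show "lookup (mon_map \<pi> m) (r j) = card (column n c j) - 1" if "column n c j \<noteq> {}" for j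
    proof -
      have j: "j < n - d" using that nonempty by blast
      show ?thesis
      proof (cases "j < l")
        case True
        have "xs ! j \<in> keys m" using True len_xs xs(2) by (metis nth_mem)
        then have "\<pi> (xs ! j) = r j" using \<pi>(2) keys_mU True by (auto simp: g_def g1)
        then have "lookup (mon_map \<pi> m) (r j) = lookup m (xs ! j)"
          using permutes_inverses(2)[OF \<pi>(1)] by (metis lookup_mon_map[OF bij])
        also have "\<dots> = exponent_partition m ! j" using True len_xs by (simp flip: xs(3))
        finally show ?thesis using c[of j] M(1) M(4)[of j] True j mP(2) by (simp add: l_def)
      next
        case False
        have "inv' \<pi> (r j) \<notin> keys m"
        proof
          assume *: "inv' \<pi> (r j) \<in> keys m"
          then have "r j = r (g1 (inv' \<pi> (r j)))"
            using \<pi>(2)[of "inv' \<pi> (r j)"] keys_mU permutes_inverses(1)[OF \<pi>(1)] by (auto simp: g_def)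
          then have "j = g1 (inv' \<pi> (r j))" using c_r j g1_less[OF *] lnd by (metis order.strict_trans2)
          then show False using False g1_less[OF *] by simp
        qed
        then show ?thesis
          using c[of j] M(1) M(5)[of j] False j mP(2) by (simp add: l_def lookup_mon_map[OF bij] in_keys_iff)
      qed
    qed
    show "keys m' \<subseteq> r ` {j. column n c j \<noteq> {}}"
      if m': "m' \<in> keys (perm_poly \<pi> P)" "mon_degree m' = d" for m'
    proof
      fix x assume x: "x \<in> keys m'"
      obtain a where a: "a \<in> keys P" "m' = mon_map \<pi> a" using keys_perm_poly m'(1) by blast
      then have "keys a \<subseteq> U" using m'(2) by (auto simp: U_def hom_component_keys)
      moreover obtain y where "y \<in> keys a" "x = \<pi> y" using x a keys_mon_map by blast
      ultimately have "x = r (g y)" "g y < n - d" using \<pi>(2) g_less by auto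
      then show "x \<in> r ` {j. column n c j \<noteq> {}}" using nonempty by blast
    qed
  qed
qed

lemma antisym_polys_subset_partition:
  assumes P: "P \<in> I" "deg_le d P" and wt: "d + wt (hom_component d P) \<le> n"
    and m: "m \<in> keys (hom_component d P)"
    and lam: "is_partition n lam" "lam \<unlhd>\<^sub>d dual_partition (mon_partition n m)"
    and c: "\<And>j. card (column n c j) = card {i. i < length lam \<and> j < lam ! i}"
  shows "antisym_polys n c \<subseteq> I"
proof -
  define M where "M = mon_partition n m"
  have "mon_weight m \<le> wt (hom_component d P)"
    unfolding mon_weight_def wt_def using m by (intro card_mono) auto
  then have "mon_degree m + mon_weight m \<le> n"
    using m wt by (simp add: hom_component_keys)
  note M = mon_partition_facts[OF this, folded M_def]
  show ?thesis
  proof (rule antisym_polys_subset_dominating)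
    show "antisym_polys n c' \<subseteq> I"
      if "\<And>j. card (column n c' j) = (if j < length M then M ! j else 0)" for c'
      using antisym_polys_subset_mon_partition[OF P wt m] that by (simp add: M_def)
    show "antimono (\<lambda>j. if j < length M then M ! j else 0)"
    proof (rule antimonoI)
      fix i j :: nat assume "i \<le> j"
      then show "(if j < length M then M ! j else 0) \<le> (if i < length M then M ! i else 0)"
        using M(3) by (cases "i = j") (auto simp: sorted_wrt_iff_nth_less)
    qed
    show "(\<Sum>j<length M. if j < length M then M ! j else 0) = n"
      using M(2) by (simp add: sum_list_sum_nth atLeast0LessThan)
    show "(\<Sum>j<t. if j < length M then M ! j else 0) \<le> (\<Sum>j<t. card (column n c j))" for t
      unfolding c using lam M(2) unfolding is_partition_def M_def[symmetric]
      by (intro conjugate_dominance) auto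
  qed simp
qed

end

section \<open>Specht polynomials\<close>

definition col_of :: "nat list \<Rightarrow> (nat \<times> nat \<Rightarrow> nat) \<Rightarrow> nat \<Rightarrow> nat" where
  "col_of lam T x = snd (inv_into (young_diagram lam) T x)"

lemma col_of_cell:
  assumes "bij_betw T (young_diagram lam) A" "(i, j) \<in> young_diagram lam"
  shows "col_of lam T (T (i, j)) = j"
  using assms by (simp add: col_of_def bij_betw_def inv_into_f_f)

lemma card_column_col_of:
  assumes T: "bij_betw T (young_diagram lam) {1..n}"
  shows "card (column n (col_of lam T) j) = card {i. i < length lam \<and> j < lam ! i}"
proof -
  have "column n (col_of lam T) j = (\<lambda>i. T (i, j)) ` {i. i < length lam \<and> j < lam ! i}"
  proof (intro equalityI subsetI)
    fix x assume x: "x \<in> column n (col_of lam T) j"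
    then have "x \<in> T ` young_diagram lam" using T by (simp add: column_def bij_betw_def)
    then obtain i k where ik: "(i, k) \<in> young_diagram lam" "x = T (i, k)" by auto
    then have "k = j" using x col_of_cell[OF T] by (auto simp: column_def)
    then show "x \<in> (\<lambda>i. T (i, j)) ` {i. i < length lam \<and> j < lam ! i}"
      using ik by (auto simp: young_diagram_def)
  next
    fix x assume "x \<in> (\<lambda>i. T (i, j)) ` {i. i < length lam \<and> j < lam ! i}"
    then obtain i where i: "(i, j) \<in> young_diagram lam" "x = T (i, j)" by (auto simp: young_diagram_def)
    moreover have "T (i, j) \<in> {1..n}" using T i(1) by (rule bij_betwE[THEN bspec])
    ultimately show "x \<in> column n (col_of lam T) j"
      using col_of_cell[OF T] unfolding column_def by simp
  qed
  moreover have "inj_on (\<lambda>i. T (i, j)) {i. i < length lam \<and> j < lam ! i}"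
    using T by (auto simp: inj_on_def bij_betw_def young_diagram_def)
  ultimately show ?thesis by (simp add: card_image)
qed

lemma finite_young_diagram: "finite (young_diagram lam)"
proof -
  have "young_diagram lam = (SIGMA i:{..<length lam}. {..<lam ! i})" by (auto simp: young_diagram_def)
  then show ?thesis by simp
qed

text \<open>
A Specht polynomial is the Vandermonde product for the orientation of the columns of the tableau from smaller to larger row index.
\<close>

lemma specht_poly_antisym:
  assumes T: "bij_betw T (young_diagram lam) {1..n}"
  shows "(specht_poly lam T :: 'k::field_char_0 mpoly) \<in> antisym_polys n (col_of lam T)"
proof -
  define Y where "Y = young_diagram lam"
  have T': "inj_on T Y" "T ` Y = {1..n}" using T by (simp_all add: bij_betw_def Y_def)
  define pairs where "pairs = (\<lambda>j. {(i, i'). (i, j) \<in> Y \<and> (i', j) \<in> Y \<and> i < i'})"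
  define Q where "Q = (SIGMA j:snd ` Y. pairs j)"
  define g where "g = (\<lambda>(j, i, i'). (T (i, j), T (i', j)))"
  have fin: "finite (pairs j)" for j
    by (rule finite_subset[of _ "fst ` Y \<times> fst ` Y"])
      (force simp: pairs_def Y_def finite_young_diagram)+
  have Q: "(j, i, i') \<in> Q \<longleftrightarrow> (i, j) \<in> Y \<and> (i', j) \<in> Y \<and> i < i'" for j i i'
    by (force simp: Q_def pairs_def)
  have inj: "inj_on g Q"
  proof (rule inj_onI)
    fix p q assume pq: "p \<in> Q" "q \<in> Q" "g p = g q"
    obtain j i i' l k k' where eqs: "p = (j, i, i')" "q = (l, k, k')" by (metis prod_cases3)
    then have "T (i, j) = T (k, l)" "T (i', j) = T (k', l)" using pq(3) by (simp_all add: g_def)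
    then have "(i, j) = (k, l)" "(i', j) = (k', l)"
      using pq(1,2) inj_onD[OF T'(1)] unfolding eqs Q by blast+
    then show "p = q" by (simp add: eqs)
  qed
  have "specht_poly lam T = (\<Prod>j\<in>snd ` Y. \<Prod>p\<in>pairs j. (\<lambda>(u, v). Var u - Var v :: 'k mpoly) (g (j, p)))"
    unfolding specht_poly_def Y_def[symmetric] pairs_def
    by (intro prod.cong refl) (auto simp: g_def)
  also have "\<dots> = (\<Prod>q\<in>Q. (\<lambda>(u, v). Var u - Var v :: 'k mpoly) (g q))"
    unfolding Q_def using fin finite_young_diagram by (subst prod.Sigma) (auto simp: Y_def)
  also have "\<dots> = vdm (g ` Q)"
    unfolding vdm_def using inj by (simp add: prod.reindex)
  finally have eq: "specht_poly lam T = (vdm (g ` Q) :: 'k mpoly)" .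
  have gQ: "(T (i, j), T (i', j')) \<in> g ` Q \<longleftrightarrow> j = j' \<and> i < i'"
    if "(i, j) \<in> Y" "(i', j') \<in> Y" for i i' j j'
  proof
    assume "(T (i, j), T (i', j')) \<in> g ` Q"
    then obtain l k k' where q: "(l, k, k') \<in> Q" "T (i, j) = T (k, l)" "T (i', j') = T (k', l)"
      by (auto simp: g_def)
    then have "(i, j) = (k, l)" "(i', j') = (k', l)"
      using inj_onD[OF T'(1)] that unfolding Q by blast+
    then show "j = j' \<and> i < i'" using q(1) by (simp add: Q)
  next
    assume "j = j' \<and> i < i'"
    then show "(T (i, j), T (i', j')) \<in> g ` Q"
      using that by (intro image_eqI[of _ _ "(j, i, i')"]) (auto simp: g_def Q)
  qed
  have sub: "g ` Q \<subseteq> {1..n} \<times> {1..n}"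
    unfolding T'(2)[symmetric] by (auto simp: g_def Q)
  have mem: "(u, v) \<in> g ` Q \<union> (g ` Q)\<inverse> \<longleftrightarrow> u \<in> {1..n} \<and> v \<in> {1..n} \<and> u \<noteq> v \<and> col_of lam T u = col_of lam T v"
    for u v
  proof (cases "u \<in> {1..n} \<and> v \<in> {1..n}")
    case True
    then obtain i j i' j' where c: "(i, j) \<in> Y" "u = T (i, j)" "(i', j') \<in> Y" "v = T (i', j')"
      unfolding T'(2)[symmetric] by auto
    have "u = v \<longleftrightarrow> i = i' \<and> j = j'" using c T'(1) by (auto simp: inj_on_def)
    moreover have "col_of lam T u = j" "col_of lam T v = j'"
      using c col_of_cell[OF T] by (simp_all add: Y_def)
    ultimately show ?thesis
      using True gQ[OF c(1,3)] gQ[OF c(3,1)] c(2,4) by auto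
  next
    case False
    then show ?thesis using sub by auto
  qed
  have "orients n (col_of lam T) (g ` Q)"
    unfolding orients_def
  proof
    show "g ` Q \<union> (g ` Q)\<inverse> = {(u, v). u \<in> {1..n} \<and> v \<in> {1..n} \<and> u \<noteq> v \<and> col_of lam T u = col_of lam T v}"
      by (rule Set.set_eqI) (simp only: mem split_paired_all mem_Collect_eq case_prod_conv)
    have "(v, u) \<notin> g ` Q" if uv: "(u, v) \<in> g ` Q" for u v
    proof -
      have "u \<in> T ` Y" "v \<in> T ` Y" using uv sub unfolding T'(2) by auto
      then obtain i j i' j' where c: "(i, j) \<in> Y" "u = T (i, j)" "(i', j') \<in> Y" "v = T (i', j')" by auto
      then show ?thesis using uv gQ[OF c(1,3)] gQ[OF c(3,1)] by auto
    qed
    then show "g ` Q \<inter> (g ` Q)\<inverse> = {}" by (simp add: disjoint_iff split_paired_all)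
  qed
  then show ?thesis unfolding eq by (rule vdm_antisym_polys)
qed

section \<open>Modules isomorphic to a Specht module\<close>

text \<open>
Specht polynomials span the Specht module, so a module \<open>W\<close> isomorphic to it is spanned by elements that are
antisymmetric under the column group of some tableau. To have \<open>W\<close> inside a subspace \<open>J\<close> it suffices
that such elements of \<open>W\<close> lie in \<open>J\<close>.
\<close>

lemma specht_submodule_subset:
  fixes U :: "('k::field_char_0, 'v, 'm) sn_module_scheme"
  assumes sub: "sn_submodule n W U"
    and iso: "sn_isomorphic n (U\<lparr>carrier := W\<rparr>) (specht_module n lam :: ('k, 'k mpoly) sn_module)"
    and zero: "\<zero>\<^bsub>U\<^esub> \<oplus>\<^bsub>U\<^esub> \<zero>\<^bsub>U\<^esub> = \<zero>\<^bsub>U\<^esub>"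
    and J: "\<zero>\<^bsub>U\<^esub> \<in> J" "\<And>x y. x \<in> J \<Longrightarrow> y \<in> J \<Longrightarrow> x \<oplus>\<^bsub>U\<^esub> y \<in> J" "\<And>a x. x \<in> J \<Longrightarrow> a \<odot>\<^bsub>U\<^esub> x \<in> J"
    and gen: "\<And>T w. bij_betw T (young_diagram lam) {1..n} \<Longrightarrow> w \<in> W \<Longrightarrow>
      (\<And>\<sigma>. \<sigma> \<in> col_group n (col_of lam T) \<Longrightarrow> act U \<sigma> w = of_int (sign \<sigma>) \<odot>\<^bsub>U\<^esub> w) \<Longrightarrow> w \<in> J"
  shows "W \<subseteq> J"
proof -
  let ?S = "specht_module n lam :: ('k, 'k mpoly) sn_module"
  have ops: "x \<oplus>\<^bsub>?S\<^esub> y = x + y" "a \<odot>\<^bsub>?S\<^esub> x = scale a x" "act ?S = perm_poly" for x y a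
    by (simp_all add: specht_module_def poly_module_def)
  have W: "submodule W (ring_of_type_algebra :: 'k ring) U" using sub by (simp add: sn_submodule_def)
  have sg: "subgroup W (add_monoid U)" using W by (rule submodule.axioms)
  have W0: "\<zero>\<^bsub>U\<^esub> \<in> W" using subgroup.one_closed[OF sg] by simp
  have Wadd: "x \<oplus>\<^bsub>U\<^esub> y \<in> W" if "x \<in> W" "y \<in> W" for x y
    using subgroup.m_closed[OF sg that] by simp
  have Wsmult: "a \<odot>\<^bsub>U\<^esub> x \<in> W" if "x \<in> W" for a x
    using submodule.smult_closed[OF W, of a x] that by (simp add: ring_of_type_algebra_def)
  have Wact: "act U \<sigma> x \<in> W" if "\<sigma> permutes {1..n}" "x \<in> W" for \<sigma> x
    using sub that by (simp add: sn_submodule_def sym_group_carrier)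
  obtain \<phi> where \<phi>: "\<phi> \<in> Group.iso (add_monoid (U\<lparr>carrier := W\<rparr>)) (add_monoid ?S)"
    and hom: "\<forall>a. \<forall>x\<in>carrier (U\<lparr>carrier := W\<rparr>).
        \<phi> (a \<odot>\<^bsub>U\<lparr>carrier := W\<rparr>\<^esub> x) = a \<odot>\<^bsub>?S\<^esub> \<phi> x"
      "\<forall>\<sigma>\<in>carrier (sym_group n). \<forall>x\<in>carrier (U\<lparr>carrier := W\<rparr>).
        \<phi> (act (U\<lparr>carrier := W\<rparr>) \<sigma> x) = act ?S \<sigma> (\<phi> x)"
    using iso unfolding sn_isomorphic_def by blast
  have smult: "\<phi> (a \<odot>\<^bsub>U\<^esub> x) = scale a (\<phi> x)" if "x \<in> W" for a x
    using hom(1) that by (simp add: ops)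
  have act: "\<phi> (act U \<sigma> x) = perm_poly \<sigma> (\<phi> x)" if "\<sigma> permutes {1..n}" "x \<in> W" for \<sigma> x
    using hom(2) that by (simp add: ops sym_group_carrier)
  have bij: "bij_betw \<phi> W (carrier ?S)" using \<phi> by (simp add: Group.iso_def)
  have add: "\<phi> (x \<oplus>\<^bsub>U\<^esub> y) = \<phi> x + \<phi> y" if "x \<in> W" "y \<in> W" for x y
    using \<phi> that hom_mult[of \<phi> "add_monoid (U\<lparr>carrier := W\<rparr>)" "add_monoid ?S" x y]
    by (simp add: Group.iso_def ops)
  have inj: "x = y" if "x \<in> W" "y \<in> W" "\<phi> x = \<phi> y" for x y
    using bij that by (auto simp: bij_betw_def inj_on_def)
  have span: "carrier ?S = {\<Sum>p\<in>F. scale (a p) p | F a. finite F \<and> F \<subseteq> specht_polys n lam}"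
    by (simp add: specht_module_def)
  \<comment> \<open>Induction over the Specht polynomials of the sum: the preimage of each of them lies in \<open>J\<close>.\<close>
  have "\<exists>w\<in>W \<inter> J. \<phi> w = (\<Sum>p\<in>F. scale (a p) p)"
    if "finite F" "F \<subseteq> specht_polys n lam" for F a
    using that
  proof (induction F rule: finite_induct)
    case empty
    have "\<phi> \<zero>\<^bsub>U\<^esub> = 0" using add[OF W0 W0] zero by simp
    then show ?case using W0 J(1) by auto
  next
    case (insert p F)
    then obtain w where w: "w \<in> W" "w \<in> J" "\<phi> w = (\<Sum>p\<in>F. scale (a p) p)" by auto
    obtain T where T: "bij_betw T (young_diagram lam) {1..n}" "p = specht_poly lam T"
      using insert.prems by (auto simp: specht_polys_def)
    have "p = (\<Sum>q\<in>{p}. scale 1 q)" by (simp add: scale_def Const_def)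
    then have "p \<in> carrier ?S"
      unfolding span mem_Collect_eq using insert.prems
      by (intro exI[of _ "{p}"] exI[of _ "\<lambda>_. 1"]) simp
    then obtain v where v: "v \<in> W" "\<phi> v = p" using bij by (metis bij_betw_imp_surj_on imageE)
    have p: "p \<in> antisym_polys n (col_of lam T)" unfolding T(2) by (rule specht_poly_antisym[OF T(1)])
    have "v \<in> J"
    proof (rule gen[OF T(1) v(1)])
      fix \<sigma> assume \<sigma>: "\<sigma> \<in> col_group n (col_of lam T)"
      have perm: "\<sigma> permutes {1..n}" using \<sigma> by (rule col_group_permutes)
      have "\<phi> (act U \<sigma> v) = \<phi> (of_int (sign \<sigma>) \<odot>\<^bsub>U\<^esub> v)"
        using p \<sigma> by (simp only: act[OF perm v(1)] smult[OF v(1)] v(2) scale_eq_of_int) (simp add: antisym_polys_def)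
      then show "act U \<sigma> v = of_int (sign \<sigma>) \<odot>\<^bsub>U\<^esub> v"
        by (rule inj[OF Wact[OF perm v(1)] Wsmult[OF v(1)]])
    qed
    then have "(a p \<odot>\<^bsub>U\<^esub> v) \<oplus>\<^bsub>U\<^esub> w \<in> W \<inter> J" using v(1) w(1,2) by (simp add: J Wadd Wsmult)
    moreover have "\<phi> ((a p \<odot>\<^bsub>U\<^esub> v) \<oplus>\<^bsub>U\<^esub> w) = (\<Sum>p\<in>insert p F. scale (a p) p)"
      using insert(1,2) v w by (simp add: add Wsmult smult)
    ultimately show ?case by blast
  qed
  note lift = this
  show ?thesis
  proof
    fix x assume x: "x \<in> W"
    have "\<phi> x \<in> carrier ?S" using bij x by (rule bij_betw_apply)
    then obtain F a where "finite F" "F \<subseteq> specht_polys n lam" "\<phi> x = (\<Sum>p\<in>F. scale (a p) p)"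
      unfolding span by blast
    then obtain w where "w \<in> W" "w \<in> J" "\<phi> w = \<phi> x" using lift[of F a] by auto
    then show "x \<in> J" using inj[of w x] x by blast
  qed
qed

section \<open>Isotypic components of spaces of polynomials\<close>

lemma finsum_eq_sum:
  fixes R :: "('v::comm_monoid_add, 'm) ring_scheme"
  assumes "abelian_monoid R" "add R = (+)" "\<zero>\<^bsub>R\<^esub> = 0" "f \<in> A \<rightarrow> carrier R"
  shows "finsum R f A = sum f A"
  using assms(4)
proof (induction A rule: infinite_finite_induct)
  case (infinite A)
  then show ?case using assms by (simp add: abelian_monoid.finsum_infinite)
next
  case empty
  then show ?case using assms by (simp add: abelian_monoid.finsum_empty)
next
  case (insert x F)
  then show ?case
    using assms by (subst abelian_monoid.finsum_insert[OF assms(1)]) auto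
qed

text \<open>
Membership conditions that characterize the submodules of a space of polynomials without reference
to the carrier in which they are considered, so that submodules of an ideal and of the whole ring can be compared.
\<close>

definition poly_submodule :: "nat \<Rightarrow> 'k::field mpoly set \<Rightarrow> bool" where
  "poly_submodule n W \<longleftrightarrow> W \<subseteq> polys n \<and> 0 \<in> W \<and> (\<forall>x\<in>W. \<forall>y\<in>W. x + y \<in> W) \<and>
     (\<forall>a. \<forall>x\<in>W. scale a x \<in> W) \<and> (\<forall>\<sigma>. \<sigma> permutes {1..n} \<longrightarrow> (\<forall>x\<in>W. perm_poly \<sigma> x \<in> W))"

lemma uminus_eq_scale: "- x = scale (- 1) x"
  by (rule poly_mapping_eqI) simp

lemma poly_submodule_polys: "poly_submodule n (polys n)"
  by (auto simp: poly_submodule_def polys_add polys_scale polys_perm_poly permutes_image)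

lemma sn_submodule_poly_module_iff:
  assumes C: "poly_submodule n C"
  shows "sn_submodule n W (poly_module n\<lparr>carrier := C\<rparr>) \<longleftrightarrow> W \<subseteq> C \<and> poly_submodule n W"
proof -
  let ?G = "add_monoid (poly_module n\<lparr>carrier := C\<rparr>)"
  have inv: "m_inv ?G x = - x" if "x \<in> C" for x
  proof -
    have "- x \<in> C" using C that by (simp add: uminus_eq_scale poly_submodule_def)
    show ?thesis
      unfolding m_inv_def
    proof (rule the_equality)
      show "- x \<in> carrier ?G \<and> x \<otimes>\<^bsub>?G\<^esub> - x = \<one>\<^bsub>?G\<^esub> \<and> - x \<otimes>\<^bsub>?G\<^esub> x = \<one>\<^bsub>?G\<^esub>"
        using \<open>- x \<in> C\<close> by (simp add: poly_module_def)
      fix y assume "y \<in> carrier ?G \<and> x \<otimes>\<^bsub>?G\<^esub> y = \<one>\<^bsub>?G\<^esub> \<and> y \<otimes>\<^bsub>?G\<^esub> x = \<one>\<^bsub>?G\<^esub>"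
      then have "y + x = 0" by (simp add: poly_module_def)
      then show "y = - x" by (simp only: eq_neg_iff_add_eq_0)
    qed
  qed
  show ?thesis
  proof
    assume "sn_submodule n W (poly_module n\<lparr>carrier := C\<rparr>)"
    then have W: "submodule W (ring_of_type_algebra :: 'a ring) (poly_module n\<lparr>carrier := C\<rparr>)"
      and act: "\<And>\<sigma> x. \<sigma> permutes {1..n} \<Longrightarrow> x \<in> W \<Longrightarrow> perm_poly \<sigma> x \<in> W"
      by (simp_all add: sn_submodule_def sym_group_carrier poly_module_def)
    have sg: "subgroup W ?G" using W by (rule submodule.axioms)
    have "W \<subseteq> C" using subgroup.subset[OF sg] by simp
    moreover have "0 \<in> W" using subgroup.one_closed[OF sg] by (simp add: poly_module_def)
    moreover have "x + y \<in> W" if "x \<in> W" "y \<in> W" for x y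
      using subgroup.m_closed[OF sg that] by (simp add: poly_module_def)
    moreover have "scale a x \<in> W" if "x \<in> W" for a x
      using submodule.smult_closed[OF W, of a x] that by (simp add: ring_of_type_algebra_def poly_module_def)
    ultimately show "W \<subseteq> C \<and> poly_submodule n W"
      using act C by (auto simp: poly_submodule_def)
  next
    assume W: "W \<subseteq> C \<and> poly_submodule n W"
    have "subgroup W ?G"
    proof (rule subgroup.intro)
      show "W \<subseteq> carrier ?G" using W by simp
      show "x \<otimes>\<^bsub>?G\<^esub> y \<in> W" if "x \<in> W" "y \<in> W" for x y
        using W that by (simp add: poly_module_def poly_submodule_def)
      show "\<one>\<^bsub>?G\<^esub> \<in> W" using W by (simp add: poly_module_def poly_submodule_def)
      show "inv\<^bsub>?G\<^esub> x \<in> W" if "x \<in> W" for x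
      proof -
        have "scale (- 1) x \<in> W" using W that unfolding poly_submodule_def by blast
        moreover have "inv\<^bsub>?G\<^esub> x = - x" using W that by (intro inv) blast
        ultimately show ?thesis by (simp only: uminus_eq_scale)
      qed
    qed
    then have "submodule W (ring_of_type_algebra :: 'a ring) (poly_module n\<lparr>carrier := C\<rparr>)"
      using W by (intro submodule.intro)
        (simp_all add: submodule_axioms_def poly_module_def poly_submodule_def)
    then show "sn_submodule n W (poly_module n\<lparr>carrier := C\<rparr>)"
      using W by (simp add: sn_submodule_def sym_group_carrier poly_module_def poly_submodule_def)
  qed
qed

lemma poly_module_carrier: "poly_module n\<lparr>carrier := polys n\<rparr> = poly_module n"
  by (simp add: poly_module_def)

lemma abelian_monoid_poly_module:
  assumes "poly_submodule n C"
  shows "abelian_monoid (poly_module n\<lparr>carrier := C\<rparr>)"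
  by (rule abelian_monoidI) (use assms in \<open>simp_all add: poly_module_def poly_submodule_def add.assoc add.commute\<close>)

lemma isotypic_component_poly_module:
  assumes C: "poly_submodule n C"
  shows "isotypic_component n lam (poly_module n\<lparr>carrier := C\<rparr>) =
    {\<Sum>W\<in>\<W>. f W | \<W> f. finite \<W> \<and> (\<forall>W\<in>\<W>. W \<subseteq> C \<and> poly_submodule n W \<and>
       sn_isomorphic n (poly_module n\<lparr>carrier := W\<rparr>) (specht_module n lam :: ('k::field, 'k mpoly) sn_module) \<and>
       f W \<in> W)}"
proof -
  have "finsum (poly_module n\<lparr>carrier := C\<rparr>) f \<W> = (\<Sum>W\<in>\<W>. f W)"
    if "\<forall>W\<in>\<W>. W \<subseteq> C \<and> poly_submodule n W \<and>
       sn_isomorphic n (poly_module n\<lparr>carrier := W\<rparr>) (specht_module n lam :: ('k, 'k mpoly) sn_module) \<and>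
       f W \<in> W" for \<W> f
    using that by (intro finsum_eq_sum abelian_monoid_poly_module C) (auto simp: poly_module_def)
  then show ?thesis
    unfolding isotypic_component_def sn_submodule_poly_module_iff[OF C]
    by (simp add: conj_ac) (smt (verit, best) Collect_cong)
qed

context symmetric_ideal
begin

lemma poly_submodule_ideal: "poly_submodule n I"
  using subset_polys zero add mult[OF polys_Const] perm by (auto simp: poly_submodule_def scale_def)

text \<open>
A class in the quotient that is antisymmetric has an antisymmetric representative up to a factor: modulo the ideal,
the antisymmetrization of \<open>f\<close> is \<open>f\<close> times the order of the column group, which is invertible in characteristic 0.
\<close>

lemma mod_antisym_in_ideal:
  assumes sub: "antisym_polys n c \<subseteq> I" and f: "f \<in> polys n"
    and mod: "\<And>\<sigma>. \<sigma> \<in> col_group n c \<Longrightarrow> perm_poly \<sigma> f - of_int (sign \<sigma>) * f \<in> I"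
  shows "f \<in> I"
proof -
  define N where "N = card (col_group n c)"
  have N: "N \<noteq> 0" using id_in_col_group[of n c] finite_col_group[of n c] by (auto simp: N_def)
  have sq: "of_int (sign \<sigma>) * (of_int (sign \<sigma>) * p) = p" for \<sigma> and p :: "'k mpoly"
    by (simp add: sign_def)
  have "(\<Sum>\<sigma>\<in>col_group n c. of_int (sign \<sigma>) * (perm_poly \<sigma> f - of_int (sign \<sigma>) * f)) \<in> I"
    by (intro sum mult polys_of_int mod)
  also have "(\<Sum>\<sigma>\<in>col_group n c. of_int (sign \<sigma>) * (perm_poly \<sigma> f - of_int (sign \<sigma>) * f)) =
      antisymmetrize n c f - of_nat N * f"
    by (simp add: right_diff_distrib sq sum_subtractf antisymmetrize_def N_def)
  finally have diff: "antisymmetrize n c f - of_nat N * f \<in> I" .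
  have "antisymmetrize n c f \<in> I" using antisymmetrize_in_antisym_polys[OF f] sub by blast
  then have "antisymmetrize n c f + Const (- 1) * (antisymmetrize n c f - of_nat N * f) \<in> I"
    using diff by (intro add mult polys_Const)
  also have "antisymmetrize n c f + Const (- 1) * (antisymmetrize n c f - of_nat N * f) = of_nat N * f"
    by (rule poly_mapping_eqI) (simp add: lookup_add lookup_minus)
  finally have "Const (1 / of_nat N) * (of_nat N * f) \<in> I" by (rule mult[OF polys_Const])
  also have "Const (1 / of_nat N) * (of_nat N * f) = f"
  proof (rule poly_mapping_eqI)
    fix m
    have "lookup (of_nat N * f) m = of_nat N * lookup f m"
      using lookup_of_int_mult[of "int N" f m] by simp
    then show "lookup (Const (1 / of_nat N) * (of_nat N * f)) m = lookup f m"
      using N unfolding lookup_Const_mult by simp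
  qed
  finally show ?thesis .
qed

lemma isotypic_component_subset:
  assumes "\<And>T. bij_betw T (young_diagram lam) {1..n} \<Longrightarrow> antisym_polys n (col_of lam T) \<subseteq> I"
  shows "isotypic_component n lam (poly_module n) \<subseteq> I"
    and "isotypic_component n lam (poly_module n\<lparr>carrier := I\<rparr>) = isotypic_component n lam (poly_module n)"
proof -
  have W: "W \<subseteq> I" if W: "poly_submodule n W"
    "sn_isomorphic n (poly_module n\<lparr>carrier := W\<rparr>) (specht_module n lam :: ('k, 'k mpoly) sn_module)" for W
  proof (rule specht_submodule_subset[OF _ W(2)])
    show "sn_submodule n W (poly_module n)"
      using sn_submodule_poly_module_iff[OF poly_submodule_polys, of n W] W(1)
      by (simp add: poly_module_carrier poly_submodule_def)
    fix T w
    assume T: "bij_betw T (young_diagram lam) {1..n}" and w: "w \<in> W"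
      and anti: "\<And>\<sigma>. \<sigma> \<in> col_group n (col_of lam T) \<Longrightarrow>
        act (poly_module n) \<sigma> w = of_int (sign \<sigma>) \<odot>\<^bsub>poly_module n\<^esub> w"
    have "w \<in> antisym_polys n (col_of lam T)"
      using anti w W(1) by (auto simp: antisym_polys_def poly_module_def scale_eq_of_int poly_submodule_def)
    then show "w \<in> I" using assms[OF T] by blast
  qed (use poly_submodule_ideal in \<open>simp_all add: poly_module_def poly_submodule_def\<close>)
  have pm: "isotypic_component n lam (poly_module n) =
    {\<Sum>W\<in>\<W>. f W | \<W> f. finite \<W> \<and> (\<forall>W\<in>\<W>. W \<subseteq> polys n \<and> poly_submodule n W \<and>
       sn_isomorphic n (poly_module n\<lparr>carrier := W\<rparr>) (specht_module n lam :: ('k, 'k mpoly) sn_module) \<and>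
       f W \<in> W)}"
    using isotypic_component_poly_module[OF poly_submodule_polys, where lam = lam and n = n]
    by (simp only: poly_module_carrier)
  show "isotypic_component n lam (poly_module n) \<subseteq> I"
  proof
    fix x :: "'k mpoly" assume "x \<in> isotypic_component n lam (poly_module n)"
    then obtain \<W> f where x: "x = (\<Sum>V\<in>\<W>. f V)" and V: "\<forall>V\<in>\<W>. V \<subseteq> polys n \<and> poly_submodule n V \<and>
        sn_isomorphic n (poly_module n\<lparr>carrier := V\<rparr>) (specht_module n lam :: ('k, 'k mpoly) sn_module) \<and> f V \<in> V"
      unfolding pm by blast
    then have "f V \<in> I" if "V \<in> \<W>" for V using W[of V] that by blast
    then show "x \<in> I" unfolding x by (rule sum)
  qed
  have "W \<subseteq> I \<and> poly_submodule n W \<and>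
      sn_isomorphic n (poly_module n\<lparr>carrier := W\<rparr>) (specht_module n lam :: ('k, 'k mpoly) sn_module) \<and> Q \<longleftrightarrow>
    W \<subseteq> polys n \<and> poly_submodule n W \<and>
      sn_isomorphic n (poly_module n\<lparr>carrier := W\<rparr>) (specht_module n lam :: ('k, 'k mpoly) sn_module) \<and> Q" for W Q
    using W[of W] unfolding poly_submodule_def by blast
  then show "isotypic_component n lam (poly_module n\<lparr>carrier := I\<rparr>) = isotypic_component n lam (poly_module n)"
    unfolding pm isotypic_component_poly_module[OF poly_submodule_ideal] by (simp only:)
qed

section \<open>Isotypic components of the quotient\<close>

lemma coset_eq: "I +>\<^bsub>mpoly_ring n\<^esub> f = (\<lambda>i. i + f) ` I"
  by (auto simp: a_r_coset_def' mpoly_ring_def)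

lemma coset_ideal:
  assumes "f \<in> I"
  shows "I +>\<^bsub>mpoly_ring n\<^esub> f = I"
proof -
  have "g \<in> (\<lambda>i. i + f) ` I" if "g \<in> I" for g
  proof (rule image_eqI)
    have "g + Const (- 1) * f \<in> I" using that assms by (intro add mult polys_Const)
    moreover have "Const (- 1) * f = - f" by (rule poly_mapping_eqI) simp
    ultimately show "g - f \<in> I" by simp
  qed simp
  then show ?thesis using assms add by (auto simp: coset_eq)
qed

text \<open>
Each generator of \<open>W\<close> is the class of a polynomial that is antisymmetric modulo the ideal, and so it is zero.
\<close>

lemma quotient_submodule_trivial:
  assumes ideal: "ideal I (mpoly_ring n)"
    and anti: "\<And>T. bij_betw T (young_diagram lam) {1..n} \<Longrightarrow> antisym_polys n (col_of lam T) \<subseteq> I"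
    and W: "sn_submodule n W (quotient_module n I)"
      "sn_isomorphic n ((quotient_module n I)\<lparr>carrier := W\<rparr>) (specht_module n lam :: ('k, 'k mpoly) sn_module)"
  shows "W \<subseteq> {\<zero>\<^bsub>quotient_module n I\<^esub>}"
proof (rule specht_submodule_subset[OF W])
  let ?Q = "quotient_module n I"
  have zero_Q: "\<zero>\<^bsub>?Q\<^esub> = I" by (simp add: quotient_module_def FactRing_def)
  have "ring (mpoly_ring n Quot I)" using ideal by (rule ideal.quotient_is_ring)
  then have "\<zero>\<^bsub>mpoly_ring n Quot I\<^esub> \<oplus>\<^bsub>mpoly_ring n Quot I\<^esub> \<zero>\<^bsub>mpoly_ring n Quot I\<^esub> = \<zero>\<^bsub>mpoly_ring n Quot I\<^esub>"
    by (simp add: ring.ring_simprules)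
  then show zz: "\<zero>\<^bsub>?Q\<^esub> \<oplus>\<^bsub>?Q\<^esub> \<zero>\<^bsub>?Q\<^esub> = \<zero>\<^bsub>?Q\<^esub>" by (simp add: quotient_module_def)
  show "\<zero>\<^bsub>?Q\<^esub> \<in> {\<zero>\<^bsub>?Q\<^esub>}" by simp
  show "x \<oplus>\<^bsub>?Q\<^esub> y \<in> {\<zero>\<^bsub>?Q\<^esub>}" if "x \<in> {\<zero>\<^bsub>?Q\<^esub>}" "y \<in> {\<zero>\<^bsub>?Q\<^esub>}" for x y using that zz by simp
  show "a \<odot>\<^bsub>?Q\<^esub> x \<in> {\<zero>\<^bsub>?Q\<^esub>}" if "x \<in> {\<zero>\<^bsub>?Q\<^esub>}" for a x
  proof -
    have "scale a i \<in> I" if "i \<in> I" for i using that unfolding scale_def by (intro mult polys_Const)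
    then have "(\<Union>i\<in>I. I +>\<^bsub>mpoly_ring n\<^esub> scale a i) = I" using zero by (auto simp: coset_ideal)
    then show ?thesis using that zero_Q by (simp add: quotient_module_def)
  qed
  fix T w
  assume T: "bij_betw T (young_diagram lam) {1..n}" and w: "w \<in> W"
    and act: "\<And>\<sigma>. \<sigma> \<in> col_group n (col_of lam T) \<Longrightarrow> act ?Q \<sigma> w = of_int (sign \<sigma>) \<odot>\<^bsub>?Q\<^esub> w"
  have "subgroup W (add_monoid ?Q)"
    using W(1) submodule.axioms(1) by (auto simp: sn_submodule_def)
  then have "w \<in> carrier (mpoly_ring n Quot I)"
    using w subgroup.subset by (fastforce simp: quotient_module_def)
  then obtain f where f: "f \<in> polys n" "w = I +>\<^bsub>mpoly_ring n\<^esub> f"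
    by (auto simp: FactRing_def A_RCOSETS_def' mpoly_ring_def)
  have "f \<in> I"
  proof (rule mod_antisym_in_ideal[OF anti[OF T] f(1)])
    fix \<sigma> assume \<sigma>: "\<sigma> \<in> col_group n (col_of lam T)"
    have "(\<Union>a\<in>w. I +>\<^bsub>mpoly_ring n\<^esub> perm_poly \<sigma> a) = (\<Union>a\<in>w. I +>\<^bsub>mpoly_ring n\<^esub> scale (of_int (sign \<sigma>)) a)"
      using act[OF \<sigma>] by (simp add: quotient_module_def)
    \<comment> \<open>The element \<open>\<sigma> f\<close> of the left-hand side also lies in the right-hand side.\<close>
    moreover have "f \<in> w" "perm_poly \<sigma> f \<in> I +>\<^bsub>mpoly_ring n\<^esub> perm_poly \<sigma> f"
      using zero by (auto simp: f(2) coset_eq intro: image_eqI[of _ _ 0])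
    ultimately obtain a where "a \<in> w" "perm_poly \<sigma> f \<in> I +>\<^bsub>mpoly_ring n\<^esub> scale (of_int (sign \<sigma>)) a" by blast
    then obtain i i' where i: "i \<in> I" "i' \<in> I" "perm_poly \<sigma> f = i' + of_int (sign \<sigma>) * (i + f)"
      by (auto simp: f(2) coset_eq scale_eq_of_int)
    have "i' + of_int (sign \<sigma>) * i \<in> I" using i by (intro add mult polys_of_int)
    then show "perm_poly \<sigma> f - of_int (sign \<sigma>) * f \<in> I" by (simp add: i(3) distrib_left)
  qed
  then show "w \<in> {\<zero>\<^bsub>?Q\<^esub>}" by (simp add: f(2) coset_ideal zero_Q)
qed

lemma isotypic_component_quotient:
  assumes ideal: "ideal I (mpoly_ring n)"
    and anti: "\<And>T. bij_betw T (young_diagram lam) {1..n} \<Longrightarrow> antisym_polys n (col_of lam T) \<subseteq> I"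
  shows "isotypic_component n lam (quotient_module n I) = {\<zero>\<^bsub>quotient_module n I\<^esub>}"
proof -
  let ?Q = "quotient_module n I"
  have "ring (mpoly_ring n Quot I)" using ideal by (rule ideal.quotient_is_ring)
  then have mon: "abelian_monoid ?Q"
    by (intro abelian_monoidI) (simp_all add: quotient_module_def ring.ring_simprules)
  show ?thesis
  proof
    show "isotypic_component n lam ?Q \<subseteq> {\<zero>\<^bsub>?Q\<^esub>}"
    proof
      fix x assume "x \<in> isotypic_component n lam ?Q"
      then obtain \<W> f where x: "x = finsum ?Q f \<W>" and "\<forall>W\<in>\<W>. sn_submodule n W ?Q \<and>
          sn_isomorphic n (?Q\<lparr>carrier := W\<rparr>) (specht_module n lam :: ('k, 'k mpoly) sn_module) \<and> f W \<in> W"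
        unfolding isotypic_component_def by blast
      then have "f W = \<zero>\<^bsub>?Q\<^esub>" if "W \<in> \<W>" for W
        using quotient_submodule_trivial[OF ideal anti, where W = W] that by blast
      then have "x = \<zero>\<^bsub>?Q\<^esub>"
        unfolding x using comm_monoid.finprod_one_eqI[OF abelian_monoid.a_comm_monoid[OF mon], of \<W> f] by (simp add: finsum_def)
      then show "x \<in> {\<zero>\<^bsub>?Q\<^esub>}" by simp
    qed
    have "\<zero>\<^bsub>?Q\<^esub> = finsum ?Q f {}" for f using mon by (simp add: abelian_monoid.finsum_empty)
    then show "{\<zero>\<^bsub>?Q\<^esub>} \<subseteq> isotypic_component n lam ?Q"
      unfolding isotypic_component_def by blast
  qed
qed

end

section \<open>Vanishing of isotypic components\<close>

lemma symmetric_idealI: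
  fixes I :: "'k::field_char_0 mpoly set"
  assumes "ideal I (mpoly_ring n)" "symmetric n I"
  shows "symmetric_ideal n I"
proof -
  interpret ideal I "mpoly_ring n" by fact
  show ?thesis
  proof
    show "p \<in> polys n" if "p \<in> I" for p using Icarr[OF that] by (simp add: mpoly_ring_def)
    show "0 \<in> I" using additive_subgroup.zero_closed[OF is_additive_subgroup] by (simp add: mpoly_ring_def)
    show "p + q \<in> I" if "p \<in> I" "q \<in> I" for p q
      using additive_subgroup.a_closed[OF is_additive_subgroup that] by (simp add: mpoly_ring_def)
    show "p * q \<in> I" if "p \<in> polys n" "q \<in> I" for p q
      using I_l_closed[of q p] that by (simp add: mpoly_ring_def)
    show "perm_poly \<sigma> p \<in> I" if "\<sigma> permutes {1..n}" "p \<in> I" for \<sigma> p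
      using assms(2) that by (simp add: symmetric_def sym_group_carrier)
  qed
qed

theorem theorem5:
  fixes n d :: nat
    and I :: "'k::field_char_0 mpoly set"
    and P :: "'k mpoly"
    and m :: mon
    and lam :: "nat list"
  assumes "ideal I (mpoly_ring n)"
    and "symmetric n I"
    and "P \<in> I"
    and "poly_degree P = d"
    and "d + wt (hom_component d P) \<le> n"
    and "m \<in> Poly_Mapping.keys (hom_component d P)"
    and "is_partition n lam"
    and "lam \<unlhd>\<^sub>d dual_partition (mon_partition n m)"
  shows "isotypic_component n lam (poly_module n) \<subseteq> I \<and>
    isotypic_component n lam (poly_module n \<lparr>carrier := I\<rparr>) = isotypic_component n lam (poly_module n) \<and>
    isotypic_component n lam (quotient_module n I) = {\<zero>\<^bsub>quotient_module n I\<^esub>}"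
proof -
  interpret symmetric_ideal n I using assms(1,2) by (rule symmetric_idealI)
  have "antisym_polys n (col_of lam T) \<subseteq> I" if "bij_betw T (young_diagram lam) {1..n}" for T
    using assms(3-8) deg_le_poly_degree[of P] card_column_col_of[OF that]
    by (intro antisym_polys_subset_partition) simp_all
  then show ?thesis
    using isotypic_component_subset isotypic_component_quotient[OF assms(1)] by blast
qed

end
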